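(* Let $a\in(1/3,1/2)$ and, for $\varepsilon\in[0,1/10]$, let $F_\varepsilon\subset\mathbb{R}^2$ be the attractor of the iterated function system $\{S_1,\dots,S_5\}$ given by $$S_i\begin{pmatrix} x\\ y\end{pmatrix}=\begin{pmatrix} a&0\\ 0&1/3\end{pmatrix}\begin{pmatrix} x\\ y\end{pmatrix}+\begin{pmatrix} 0\\ (i-1)/3\end{pmatrix}\ (i=1,2,3),\qquad S_4\begin{pmatrix} x\\ y\end{pmatrix}=\begin{pmatrix} a&0\\ 0&1/3\end{pmatrix}\begin{pmatrix} x\\ y\end{pmatrix}+\begin{pmatrix} 1-a\\ 0\end{pmatrix},$$ $$S_5\begin{pmatrix} x\\ y\end{pmatrix}=\begin{pmatrix} 0&\varepsilon\\ \varepsilon&0\end{pmatrix}\begin{pmatrix} x\\ y\end{pmatrix}+\begin{pmatrix} 9/10\\ 9/10\end{pmatrix}.$$ Then the associated pressure $P_\varepsilon(s)$ is discontinuous, as a function of $\varepsilon$, at $\varepsilon=0$, and the box dimension $\dim_{\mathrm B}F_\varepsilon$ is discontinuous, as a function of $\varepsilon$, at $\varepsilon=0$.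
   Context: The attractor $F_\varepsilon$ is the unique non-empty compact set with $F_\varepsilon=\bigcup_{i=1}^5S_i(F_\varepsilon)$. Let $\mathcal I=\{1,2,3,4,5\}$. For a word $\mathbf i=i_1\cdots i_k\in\mathcal I^k$ write $S_{\mathbf i}=S_{i_1}\circ\cdots\circ S_{i_k}$ and let $\alpha_1(\mathbf i)\ge\alpha_2(\mathbf i)$ be the singular values of its linear part. Let $p_1(\mathbf i)$ be the box dimension of the projection of $F_\varepsilon$ onto the coordinate axis parallel to the longest side of the rectangle $S_{\mathbf i}([0,1]^2)$. The pressure is $$P_\varepsilon(s)=\lim_{k\to\infty}\Big(\sum_{\mathbf i\in\mathcal I^k}\alpha_1(\mathbf i)^{p_1(\mathbf i)}\alpha_2(\mathbf i)^{s-p_1(\mathbf i)}\Big)^{1/k},$$ where, when $\varepsilon=0$, words containing the symbol $5$ (whose linear part is zero) contribute $0$ to the sum. The box dimension $\dim_{\mathrm B}F_\varepsilon$ exists and is the root $s$ of $P_\varepsilon(s)=1$ (a known result on planar box-like self-affine sets). Box dimension is $\dim_{\mathrm B}E=\lim_{\delta\to0}\log N_\delta(E)/(-\log\delta)$, with $N_\delta(E)$ the minimum number of squares of sidelength $\delta$ needed to cover $E$. *)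

theory Defs
  imports "HOL-Analysis.Analysis"
begin

definition is_square :: "real \<Rightarrow> (real^2) set \<Rightarrow> bool" where
  "is_square \<delta> Q \<longleftrightarrow> (\<exists>c. Q = cbox c (c + \<delta> *\<^sub>R One))"

definition covering_number :: "real \<Rightarrow> (real^2) set \<Rightarrow> nat" where
  "covering_number \<delta> E =
     (LEAST n. \<exists>\<Q>. finite \<Q> \<and> card \<Q> = n \<and> (\<forall>Q\<in>\<Q>. is_square \<delta> Q) \<and> E \<subseteq> \<Union>\<Q>)"

definition box_dim :: "(real^2) set \<Rightarrow> real" where
  "box_dim E = Lim (at_right 0) (\<lambda>\<delta>. ln (real (covering_number \<delta> E)) / (- ln \<delta>))"

definition singular_values :: "real^2^2 \<Rightarrow> real set" where
  "singular_values A =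
     {\<sigma>. \<sigma> \<ge> 0 \<and> (\<exists>v. v \<noteq> 0 \<and> (transpose A ** A) *v v = \<sigma>\<^sup>2 *\<^sub>R v)}"

text \<open>In dimension two a repeated singular value is both the maximum and the minimum.\<close>

definition alpha1 :: "real^2^2 \<Rightarrow> real" where
  "alpha1 A = Max (singular_values A)"

definition alpha2 :: "real^2^2 \<Rightarrow> real" where
  "alpha2 A = Min (singular_values A)"

definition linear_part :: "(real^2 \<Rightarrow> real^2) \<Rightarrow> real^2^2" where
  "linear_part f = matrix (\<lambda>v. f v - f 0)"

definition ifs_map :: "real \<Rightarrow> real \<Rightarrow> nat \<Rightarrow> real^2 \<Rightarrow> real^2" where
  "ifs_map a \<epsilon> i v =
     (if i \<in> {1, 2, 3} then
        vector [vector [a, 0], vector [0, 1/3]] *v v + vector [0, (real i - 1) / 3]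
      else if i = 4 then
        vector [vector [a, 0], vector [0, 1/3]] *v v + vector [1 - a, 0]
      else
        vector [vector [0, \<epsilon>], vector [\<epsilon>, 0]] *v v + vector [9/10, 9/10])"

definition attractor :: "real \<Rightarrow> real \<Rightarrow> (real^2) set" where
  "attractor a \<epsilon> =
     (THE F. F \<noteq> {} \<and> compact F \<and> F = (\<Union>i\<in>{1..5}. ifs_map a \<epsilon> i ` F))"

definition words :: "nat \<Rightarrow> nat list set" where
  "words k = {w. length w = k \<and> set w \<subseteq> {1..5}}"

definition word_map :: "real \<Rightarrow> real \<Rightarrow> nat list \<Rightarrow> real^2 \<Rightarrow> real^2" where
  "word_map a \<epsilon> w = foldr (\<lambda>i g. ifs_map a \<epsilon> i \<circ> g) w id"

definition axis_projection :: "2 \<Rightarrow> real^2 \<Rightarrow> real^2" where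
  "axis_projection j v = axis j (v $ j)"

definition side_length :: "2 \<Rightarrow> (real^2) set \<Rightarrow> real" where
  "side_length j R = diameter ((\<lambda>v. v $ j) ` R)"

text \<open>For a square either axis may be chosen, since then \<open>\<alpha>\<^sub>1 = \<alpha>\<^sub>2\<close> and the summand
  \<open>\<alpha>\<^sub>1\<^sup>p \<alpha>\<^sub>2\<^sup>s\<^sup>-\<^sup>p\<close> of the pressure does not depend on \<open>p\<close>.\<close>

definition longest_axis :: "(real^2) set \<Rightarrow> 2" where
  "longest_axis R = (if side_length 2 R \<le> side_length 1 R then 1 else 2)"

definition p1 :: "real \<Rightarrow> real \<Rightarrow> nat list \<Rightarrow> real" where
  "p1 a \<epsilon> w =
     box_dim (axis_projection (longest_axis (word_map a \<epsilon> w ` cbox 0 One)) ` attractor a \<epsilon>)"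

text \<open>Since \<open>0 powr x = 0\<close> for every \<open>x\<close>, the words whose linear part vanishes
  (those containing the symbol 5 when \<open>\<epsilon> = 0\<close>) contribute 0 to the sum.\<close>

definition pressure_sum :: "real \<Rightarrow> real \<Rightarrow> real \<Rightarrow> nat \<Rightarrow> real" where
  "pressure_sum a \<epsilon> s k =
     (\<Sum>w\<in>words k. alpha1 (linear_part (word_map a \<epsilon> w)) powr p1 a \<epsilon> w
                   * alpha2 (linear_part (word_map a \<epsilon> w)) powr (s - p1 a \<epsilon> w))"

definition pressure :: "real \<Rightarrow> real \<Rightarrow> real \<Rightarrow> real" where
  "pressure a \<epsilon> s = lim (\<lambda>k. pressure_sum a \<epsilon> s k powr (1 / real k))"

end

theory Submission imports Defs begin

text \<open>The dimension of the projection of \<open>F\<^sub>\<epsilon>\<close> to the horizontal axis jumps at \<open>\<epsilon> = 0\<close>, and both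
discontinuities come from this jump.  At \<open>\<epsilon> = 0\<close> that projection is the Cantor set of ratio \<open>a\<close>
together with the orbit of one point, which does not affect its dimension \<open>d = ln 2 / (- ln a) < 1\<close>.  For every
\<open>\<epsilon> > 0\<close> the map \<open>S\<^sub>5\<close> exchanges the axes, so it copies the vertical projection, which is
\<open>[0,1]\<close>, into the horizontal one; both projections then have dimension 1, however small \<open>\<epsilon>\<close> is.

For the pressure at \<open>\<epsilon> = 0\<close> only the \<open>4\<^sup>k\<close> words over \<open>{1,2,3,4}\<close> count, each with singular values
\<open>a\<^sup>k \<ge> 3\<^sup>-\<^sup>k\<close>, whence \<open>P\<^sub>0(s) = 4 a\<^sup>d 3\<^sup>d\<^sup>-\<^sup>s = 2 \<cdot> 3\<^sup>d\<^sup>-\<^sup>s\<close> (\<open>pressure_zero\<close>).  For \<open>\<epsilon> > 0\<close> the very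
same words already contribute \<open>(4 a 3\<^sup>1\<^sup>-\<^sup>s)\<^sup>k\<close>, so \<open>P\<^sub>\<epsilon>(s) \<ge> 4 a 3\<^sup>1\<^sup>-\<^sup>s\<close> (\<open>pressure_ge\<close>).  The
quotient of the two values is \<open>(3a)\<^sup>1\<^sup>-\<^sup>d > 1\<close>, independently of \<open>\<epsilon>\<close>.  Since \<open>lim\<close> says nothing about a
divergent sequence, the bound needs convergence of the roots: the weight of a word is
\<open>\<alpha>\<^sub>1\<^sup>2\<^sup>-\<^sup>s (\<alpha>\<^sub>1 \<alpha>\<^sub>2)\<^sup>s\<^sup>-\<^sup>1\<close>, in which \<open>\<alpha>\<^sub>1 \<alpha>\<^sub>2\<close> is multiplicative and \<open>\<alpha>\<^sub>1\<close> submultiplicative, so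
the sums are submultiplicative for \<open>s \<le> 2\<close> and supermultiplicative for \<open>s \<ge> 2\<close>, and Fekete's lemma
applies (\<open>subadditive_convergent\<close>).

For the box dimension, too, the limit must be shown to exist.  In every case \<open>N\<^sub>\<delta>\<close> is compared with a
power of \<open>\<delta>\<close> up to constants, from above by explicit covers and from below by explicit separated finite sets (\<open>box_dim_eqI\<close>).

For \<open>\<epsilon> > 0\<close>, an image of the unit square with sides \<open>x, y\<close> has four children with sides
\<open>a x, y/3\<close> and one with sides \<open>\<epsilon> y, \<epsilon> x\<close>.  The weight
\<open>\<phi>(x,y) = (p x\<^sup>2\<^sup>-\<^sup>s + q y\<^sup>2\<^sup>-\<^sup>s) (x y)\<^sup>s\<^sup>-\<^sup>1\<close> is carried by this subdivision to a weight of the same form,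
by a symmetric 2 by 2 matrix acting on \<open>(p, q)\<close>.  If \<open>s\<close> is chosen such that this matrix has
eigenvalue 1 with a positive eigenvector, \<open>\<phi>\<close> is conserved exactly (\<open>weight_conserved\<close>), and
subdividing until the short side is about \<open>\<delta>\<close> gives \<open>N\<^sub>\<delta> = \<delta>\<^sup>-\<^sup>s\<close> up to constant factors
(\<open>cover_image\<close>, \<open>packing_image\<close>).  The diagonal entry \<open>4 a 3\<^sup>1\<^sup>-\<^sup>s\<close> of the matrix is below 1, which says
\<open>s > 1 + ln (4a) / ln 3\<close> (\<open>box_dim_F_gt\<close>).  At \<open>\<epsilon> = 0\<close> the dimension is \<open>d + ln 2 / ln 3\<close>
(\<open>box_dim_F_zero\<close>), which is smaller by at least \<open>(1 - d) ln (3a) / ln 3\<close>.\<close>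

section \<open>Coordinates and axis-parallel affine maps\<close>

lemma One_component [simp]: "(\<Sum>b\<in>Basis. (b :: real^2) $ i) = 1"
  using inner_sum_left_Basis[of "axis i 1 :: real^2"]
  by (simp add: cart_eq_inner_axis[of _ i] inner_sum_left[symmetric] axis_in_Basis_iff)

lemma vec2_eq_iff: "(u :: real^2) = v \<longleftrightarrow> u $ 1 = v $ 1 \<and> u $ 2 = v $ 2"
  by (simp add: vec_eq_iff forall_2)

lemma ifs_map_component:
  "ifs_map a \<epsilon> i v $ 1 = (if i \<in> {1, 2, 3} then a * v $ 1 else if i = 4 then a * v $ 1 + (1 - a)
     else \<epsilon> * v $ 2 + 9/10)"
  "ifs_map a \<epsilon> i v $ 2 = (if i \<in> {1, 2, 3} then v $ 2 / 3 + (real i - 1) / 3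
     else if i = 4 then v $ 2 / 3 else \<epsilon> * v $ 1 + 9/10)"
  by (auto simp: ifs_map_def matrix_vector_mult_def sum_2)

lemma atLeastAtMost_1_5: "{1..5::nat} = {1, 2, 3, 4, 5}"
  by auto

text \<open>The columns of the linear part have lengths \<open>x\<close> and \<open>y\<close>.  Recording columns rather than the two
entries of a diagonal or antidiagonal matrix makes the effect on distances and on singular values
independent of whether the axes are exchanged.\<close>

definition axis_affine :: "(real^2 \<Rightarrow> real^2) \<Rightarrow> real \<Rightarrow> real \<Rightarrow> bool" where
  "axis_affine f x y \<longleftrightarrow> (\<exists>t u.
     (\<forall>v. f v $ 1 = x * v $ 1 + t \<and> f v $ 2 = y * v $ 2 + u) \<or>
     (\<forall>v. f v $ 1 = y * v $ 2 + t \<and> f v $ 2 = x * v $ 1 + u))"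

lemma axis_affine_id: "axis_affine id 1 1"
  by (force simp: axis_affine_def)

lemma axis_affine_ifs_map:
  "i \<in> {1..4} \<Longrightarrow> axis_affine (ifs_map a \<epsilon> i) a (1/3)"
  "axis_affine (ifs_map a \<epsilon> 5) \<epsilon> \<epsilon>"
proof -
  show "axis_affine (ifs_map a \<epsilon> i) a (1/3)" if "i \<in> {1..4}"
    unfolding axis_affine_def using that
    by (intro exI[of _ "if i = 4 then 1 - a else 0"]
        exI[of _ "if i = 4 then 0 else (real i - 1) / 3"] disjI1)
      (auto simp: ifs_map_component)
  show "axis_affine (ifs_map a \<epsilon> 5) \<epsilon> \<epsilon>"
    unfolding axis_affine_def
    by (intro exI[of _ "9/10"] disjI2) (auto simp: ifs_map_component)
qed

text \<open>The first alternative holds when \<open>g\<close> keeps the axes, the second when it exchanges them.\<close>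

lemma axis_affine_comp:
  assumes "axis_affine f x y" "axis_affine g x' y'"
  shows "axis_affine (f \<circ> g) (x * x') (y * y') \<or> axis_affine (f \<circ> g) (y * x') (x * y')"
proof -
  obtain t u where f: "(\<forall>v. f v $ 1 = x * v $ 1 + t \<and> f v $ 2 = y * v $ 2 + u) \<or>
     (\<forall>v. f v $ 1 = y * v $ 2 + t \<and> f v $ 2 = x * v $ 1 + u)"
    using assms(1) unfolding axis_affine_def by blast
  obtain t' u' where g: "(\<forall>v. g v $ 1 = x' * v $ 1 + t' \<and> g v $ 2 = y' * v $ 2 + u') \<or>
     (\<forall>v. g v $ 1 = y' * v $ 2 + t' \<and> g v $ 2 = x' * v $ 1 + u')"
    using assms(2) unfolding axis_affine_def by blast
  show ?thesis
    using f g
  proof (elim disjE)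
    assume *: "\<forall>v. f v $ 1 = x * v $ 1 + t \<and> f v $ 2 = y * v $ 2 + u"
      "\<forall>v. g v $ 1 = x' * v $ 1 + t' \<and> g v $ 2 = y' * v $ 2 + u'"
    show ?thesis unfolding axis_affine_def
      by (intro disjI1 exI[of _ "x * t' + t"] exI[of _ "y * u' + u"]) (simp add: * algebra_simps)
  next
    assume *: "\<forall>v. f v $ 1 = x * v $ 1 + t \<and> f v $ 2 = y * v $ 2 + u"
      "\<forall>v. g v $ 1 = y' * v $ 2 + t' \<and> g v $ 2 = x' * v $ 1 + u'"
    show ?thesis unfolding axis_affine_def
      by (rule disjI2, rule exI[of _ "x * t' + t"], rule exI[of _ "y * u' + u"])
        (simp add: * algebra_simps)
  next
    assume *: "\<forall>v. f v $ 1 = y * v $ 2 + t \<and> f v $ 2 = x * v $ 1 + u"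
      "\<forall>v. g v $ 1 = x' * v $ 1 + t' \<and> g v $ 2 = y' * v $ 2 + u'"
    show ?thesis unfolding axis_affine_def
      by (rule disjI1, rule exI[of _ "y * u' + t"], rule exI[of _ "x * t' + u"])
        (simp add: * algebra_simps)
  next
    assume *: "\<forall>v. f v $ 1 = y * v $ 2 + t \<and> f v $ 2 = x * v $ 1 + u"
      "\<forall>v. g v $ 1 = y' * v $ 2 + t' \<and> g v $ 2 = x' * v $ 1 + u'"
    show ?thesis unfolding axis_affine_def
      by (rule disjI2, rule exI[of _ "y * u' + t"], rule exI[of _ "x * t' + u"])
        (simp add: * algebra_simps)
  qed
qed

text \<open>Subdividing a rectangle composes on the right with a generating map, for which it is known whether
the axes are exchanged.\<close>

lemma axis_affine_comp_ifs_map: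
  assumes "axis_affine f x y"
  shows "i \<in> {1..4} \<Longrightarrow> axis_affine (f \<circ> ifs_map a \<epsilon> i) (x * a) (y / 3)"
    and "axis_affine (f \<circ> ifs_map a \<epsilon> 5) (y * \<epsilon>) (x * \<epsilon>)"
proof -
  obtain t u where f: "(\<forall>v. f v $ 1 = x * v $ 1 + t \<and> f v $ 2 = y * v $ 2 + u) \<or>
     (\<forall>v. f v $ 1 = y * v $ 2 + t \<and> f v $ 2 = x * v $ 1 + u)"
    using assms(1) unfolding axis_affine_def by blast
  show "axis_affine (f \<circ> ifs_map a \<epsilon> i) (x * a) (y / 3)" if i: "i \<in> {1..4}"
  proof -
    define t' u' where "t' = (if i = 4 then 1 - a else 0)"
      and "u' = (if i = 4 then 0 else (real i - 1) / 3)"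
    have g: "ifs_map a \<epsilon> i v $ 1 = a * v $ 1 + t'" "ifs_map a \<epsilon> i v $ 2 = v $ 2 / 3 + u'" for v
      using i by (auto simp: ifs_map_component t'_def u'_def)
    from f show ?thesis
    proof
      assume *: "\<forall>v. f v $ 1 = x * v $ 1 + t \<and> f v $ 2 = y * v $ 2 + u"
      show ?thesis unfolding axis_affine_def
        by (rule exI[of _ "x * t' + t"], rule exI[of _ "y * u' + u"])
          (simp add: * g algebra_simps)
    next
      assume *: "\<forall>v. f v $ 1 = y * v $ 2 + t \<and> f v $ 2 = x * v $ 1 + u"
      show ?thesis unfolding axis_affine_def
        by (rule exI[of _ "y * u' + t"], rule exI[of _ "x * t' + u"])
          (simp add: * g algebra_simps)
    qed
  qed
  from f show "axis_affine (f \<circ> ifs_map a \<epsilon> 5) (y * \<epsilon>) (x * \<epsilon>)"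
  proof
    assume *: "\<forall>v. f v $ 1 = x * v $ 1 + t \<and> f v $ 2 = y * v $ 2 + u"
    show ?thesis unfolding axis_affine_def
      by (rule exI[of _ "x * (9/10) + t"], rule exI[of _ "y * (9/10) + u"])
        (simp add: * ifs_map_component algebra_simps)
  next
    assume *: "\<forall>v. f v $ 1 = y * v $ 2 + t \<and> f v $ 2 = x * v $ 1 + u"
    show ?thesis unfolding axis_affine_def
      by (rule exI[of _ "y * (9/10) + t"], rule exI[of _ "x * (9/10) + u"])
        (simp add: * ifs_map_component algebra_simps)
  qed
qed

lemma axis_affine_infnorm:
  assumes "axis_affine f x y" "x \<ge> 0" "y \<ge> 0"
  shows "infnorm (f p - f q) = max (x * \<bar>p $ 1 - q $ 1\<bar>) (y * \<bar>p $ 2 - q $ 2\<bar>)"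
proof -
  have "\<bar>x * b - x * c\<bar> = x * \<bar>b - c\<bar>" "\<bar>y * b - y * c\<bar> = y * \<bar>b - c\<bar>" for b c
    using assms by (simp_all add: abs_mult right_diff_distrib[symmetric])
  then show ?thesis
    using assms(1) by (auto simp: axis_affine_def infnorm_2 max.commute)
qed

lemma axis_affine_bij:
  assumes "axis_affine f x y" "x > 0" "y > 0"
  shows "bij f"
proof (rule bijI)
  show "inj f"
  proof (rule injI)
    fix p q assume "f p = f q"
    then have "max (x * \<bar>p $ 1 - q $ 1\<bar>) (y * \<bar>p $ 2 - q $ 2\<bar>) = 0"
      using axis_affine_infnorm[OF assms(1), of p q] assms by (simp add: infnorm_0)
    moreover have "x * \<bar>p $ 1 - q $ 1\<bar> \<ge> 0" "y * \<bar>p $ 2 - q $ 2\<bar> \<ge> 0"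
      using assms by simp_all
    ultimately have "x * \<bar>p $ 1 - q $ 1\<bar> = 0" "y * \<bar>p $ 2 - q $ 2\<bar> = 0"
      by linarith+
    then show "p = q"
      using assms by (simp add: vec2_eq_iff)
  qed
  obtain t u where f: "(\<forall>v. f v $ 1 = x * v $ 1 + t \<and> f v $ 2 = y * v $ 2 + u) \<or>
     (\<forall>v. f v $ 1 = y * v $ 2 + t \<and> f v $ 2 = x * v $ 1 + u)"
    using assms(1) unfolding axis_affine_def by blast
  show "surj f"
  proof (rule surjI)
    fix z :: "real^2"
    show "f (if \<forall>v. f v $ 1 = x * v $ 1 + t \<and> f v $ 2 = y * v $ 2 + u
         then vector [(z $ 1 - t) / x, (z $ 2 - u) / y]
         else vector [(z $ 2 - u) / x, (z $ 1 - t) / y]) = z"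
      using f assms(2,3) by (auto simp: vec2_eq_iff)
  qed
qed

lemma linear_part_axis_affine:
  assumes "axis_affine f x y"
  shows "linear_part f = vector [vector [x, 0], vector [0, y]] \<or>
    linear_part f = vector [vector [0, y], vector [x, 0]]"
proof -
  have "linear_part f $ i $ j = f (axis j 1) $ i - f 0 $ i" for i j
    by (simp add: linear_part_def matrix_def)
  moreover have "axis j (1::real) $ i = (if i = j then 1 else 0)" for i j :: 2
    by (simp add: axis_def)
  ultimately show ?thesis
    using assms by (auto simp: axis_affine_def vec_eq_iff forall_2)
qed

text \<open>The Gram matrix is diagonal with entries \<open>x\<^sup>2\<close> and \<open>y\<^sup>2\<close> in both orientations.\<close>

lemma singular_values_axis_affine:
  assumes "axis_affine f x y" "x \<ge> 0" "y \<ge> 0"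
  shows "singular_values (linear_part f) = {x, y}"
proof -
  define A where "A = linear_part f"
  have "A = vector [vector [x, 0], vector [0, y]] \<or> A = vector [vector [0, y], vector [x, 0]]"
    unfolding A_def by (rule linear_part_axis_affine[OF assms(1)])
  then have G: "(transpose A ** A) *v v = vector [x\<^sup>2 * v $ 1, y\<^sup>2 * v $ 2]" for v
    by (elim disjE) (simp_all add: vec2_eq_iff matrix_vector_mult_def matrix_matrix_mult_def
        transpose_def sum_2 power2_eq_square)
  have "\<sigma> \<in> singular_values A \<longleftrightarrow> \<sigma> \<in> {x, y}" for \<sigma>
  proof -
    have "(\<exists>v :: real^2. v \<noteq> 0 \<and> x\<^sup>2 * v $ 1 = \<sigma>\<^sup>2 * v $ 1 \<and> y\<^sup>2 * v $ 2 = \<sigma>\<^sup>2 * v $ 2)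
        \<longleftrightarrow> x\<^sup>2 = \<sigma>\<^sup>2 \<or> y\<^sup>2 = \<sigma>\<^sup>2" (is "?L \<longleftrightarrow> ?R")
    proof
      assume ?L then show ?R by (auto simp: vec2_eq_iff)
    next
      assume ?R
      then show ?L
      proof
        assume "x\<^sup>2 = \<sigma>\<^sup>2"
        then show ?L by (intro exI[of _ "vector [1, 0]"]) (simp add: vec2_eq_iff)
      next
        assume "y\<^sup>2 = \<sigma>\<^sup>2"
        then show ?L by (intro exI[of _ "vector [0, 1]"]) (simp add: vec2_eq_iff)
      qed
    qed
    then show ?thesis
      using assms by (auto simp: singular_values_def G vec2_eq_iff)
  qed
  then show ?thesis unfolding A_def by blast
qed

lemma alpha_axis_affine:
  assumes "axis_affine f x y" "x \<ge> 0" "y \<ge> 0"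
  shows "alpha1 (linear_part f) = max x y" "alpha2 (linear_part f) = min x y"
  using singular_values_axis_affine[OF assms] by (simp_all add: alpha1_def alpha2_def)

section \<open>The attractor\<close>

definition unit_square :: "(real^2) set" where
  "unit_square = {v. 0 \<le> v $ 1 \<and> v $ 1 \<le> 1 \<and> 0 \<le> v $ 2 \<and> v $ 2 \<le> 1}"

lemma unit_square_cbox: "cbox 0 One = unit_square"
  by (auto simp: unit_square_def mem_box_cart forall_2)

locale carpet =
  fixes a \<epsilon> :: real
  assumes a: "1/3 < a" "a < 1/2" and eps: "0 \<le> \<epsilon>" "\<epsilon> \<le> 1/10"
begin

abbreviation S :: "nat \<Rightarrow> real^2 \<Rightarrow> real^2" where "S \<equiv> ifs_map a \<epsilon>"
abbreviation F :: "(real^2) set" where "F \<equiv> attractor a \<epsilon>"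

lemma S_unit_square: "v \<in> unit_square \<Longrightarrow> i \<in> {1..5} \<Longrightarrow> S i v \<in> unit_square"
proof -
  assume v: "v \<in> unit_square" and i: "i \<in> {1..5}"
  have "c * v $ j \<ge> 0 \<and> c * v $ j \<le> c" if "c \<ge> 0" "j = 1 \<or> j = 2" for c :: real and j :: 2
    using v that by (auto simp: unit_square_def mult_left_le)
  from this[of a 1] this[of \<epsilon> 1] this[of \<epsilon> 2]
  have "0 \<le> a * v $ 1" "a * v $ 1 \<le> a" "\<epsilon> * v $ 1 \<ge> 0" "\<epsilon> * v $ 1 \<le> \<epsilon>"
    "\<epsilon> * v $ 2 \<ge> 0" "\<epsilon> * v $ 2 \<le> \<epsilon>"
    using a eps by auto
  moreover from this have "a * v $ 1 \<le> 1" using a by linarith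
  ultimately show ?thesis
    using a eps v i unfolding atLeastAtMost_1_5
    by (auto simp: unit_square_def ifs_map_component)
qed

lemma continuous_S: "continuous_on X (S i)"
  unfolding ifs_map_def
  by (cases "i \<in> {1,2,3}"; cases "i = 4"; simp; intro continuous_intros)

lemma S_contraction: "i \<in> {1..5} \<Longrightarrow> dist (S i p) (S i q) \<le> dist p q / 2"
proof -
  assume i: "i \<in> {1..5}"
  have n: "dist u v = sqrt ((u $ 1 - v $ 1)\<^sup>2 + (u $ 2 - v $ 2)\<^sup>2)" for u v :: "real^2"
    by (simp add: dist_norm norm_vec_def L2_set_def sum_2)
  have m: "\<bar>c\<bar> \<le> 1/2 \<Longrightarrow> (c * b)\<^sup>2 \<le> b\<^sup>2 / 4" for b c :: real
  proof -
    assume "\<bar>c\<bar> \<le> 1/2"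
    then have "c\<^sup>2 \<le> (1/2)\<^sup>2" by (rule power2_le_iff_abs_le[THEN iffD2, rotated]) simp
    then have "c\<^sup>2 * b\<^sup>2 \<le> 1/4 * b\<^sup>2" by (intro mult_right_mono) (simp_all add: power2_eq_square)
    then show ?thesis by (simp add: power_mult_distrib)
  qed
  have "dist (S i p) (S i q) \<le> sqrt (((p $ 1 - q $ 1)\<^sup>2 + (p $ 2 - q $ 2)\<^sup>2) / 4)"
  proof (cases "i = 5")
    case True
    have "(\<epsilon> * (p $ 1 - q $ 1))\<^sup>2 \<le> (p $ 1 - q $ 1)\<^sup>2 / 4" "(\<epsilon> * (p $ 2 - q $ 2))\<^sup>2 \<le> (p $ 2 - q $ 2)\<^sup>2 / 4"
      using eps by (intro m; simp)+
    then show ?thesis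
      unfolding n using True by (intro real_sqrt_le_mono) (simp add: ifs_map_component algebra_simps)
  next
    case False
    have "(a * (p $ 1 - q $ 1))\<^sup>2 \<le> (p $ 1 - q $ 1)\<^sup>2 / 4" "((1/3) * (p $ 2 - q $ 2))\<^sup>2 \<le> (p $ 2 - q $ 2)\<^sup>2 / 4"
      using a by (intro m; simp)+
    moreover have "(S i p $ 1 - S i q $ 1) = a * (p $ 1 - q $ 1)"
      "(S i p $ 2 - S i q $ 2) = (1/3) * (p $ 2 - q $ 2)"
      using i False by (auto simp: ifs_map_component algebra_simps)
    ultimately show ?thesis
      unfolding n by (intro real_sqrt_le_mono) (simp only:, argo)
  qed
  also have "\<dots> = dist p q / 2" by (simp add: n real_sqrt_divide)
  finally show ?thesis .
qed

lemma word_map_Cons: "word_map a \<epsilon> (i # w) = S i \<circ> word_map a \<epsilon> w"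
  by (simp add: word_map_def)

text \<open>Let \<open>p\<close> be a point of \<open>G\<close> at maximal distance from \<open>H\<close>.  Its preimage under a contraction of ratio
\<open>1/2\<close> lies in \<open>G\<close> at twice that distance at least, so the maximal distance is 0.  Used in both directions,
this is the uniqueness of the attractor.\<close>

lemma compact_invariant_le:
  assumes G: "compact G" "G \<noteq> {}" "G = (\<Union>i\<in>{1..5}. S i ` G)"
    and H: "compact H" "H \<noteq> {}" "H = (\<Union>i\<in>{1..5}. S i ` H)"
  shows "G \<subseteq> H"
proof -
  have "\<exists>p\<in>G. \<forall>q\<in>G. infdist q H \<le> infdist p H"
    using G by (intro continuous_attains_sup) (auto intro: continuous_intros)
  then obtain p where p: "p \<in> G" "\<And>q. q \<in> G \<Longrightarrow> infdist q H \<le> infdist p H" by blast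
  obtain i q where iq: "i \<in> {1..5}" "q \<in> G" "p = S i q" using p(1) G(3) by blast
  obtain h where h: "h \<in> H" "infdist q H = dist q h"
    using infdist_attains_inf[of H q] H by (auto simp: compact_imp_closed)
  have "S i h \<in> H" using H(3) h iq by blast
  then have "infdist p H \<le> dist p (S i h)" by (rule infdist_le)
  also have "\<dots> \<le> dist q h / 2" using S_contraction iq by blast
  also have "\<dots> \<le> infdist p H / 2" using p(2)[OF iq(2)] h by simp
  finally have "infdist p H \<le> 0" by simp
  then have "infdist q H = 0" if "q \<in> G" for q
    using p(2)[OF that] infdist_nonneg[of q H] by linarith
  then show ?thesis
    using H in_closed_iff_infdist_zero[of H] by (auto simp: compact_imp_closed)
qed

text \<open>Existence of the attractor: since \<open>S\<^sub>1 0 = 0\<close>, the orbit of 0 under all words is an invariant set, and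
invariance passes to the closure of a bounded set.\<close>

lemma orbit_closure_invariant:
  defines "K \<equiv> closure ((\<lambda>w. word_map a \<epsilon> w 0) ` {w. set w \<subseteq> {1..5}})"
  shows "K \<noteq> {}" "compact K" "K \<subseteq> unit_square" "K = (\<Union>i\<in>{1..5}. S i ` K)" "0 \<in> K"
proof -
  define W where "W = (\<lambda>w. word_map a \<epsilon> w 0) ` {w. set w \<subseteq> {1..5}}"
  have K: "K = closure W" by (simp add: K_def W_def)
  have "word_map a \<epsilon> w 0 \<in> unit_square" if "set w \<subseteq> {1..5}" for w
    using that
  proof (induction w)
    case Nil
    then show ?case by (simp add: word_map_def unit_square_def)
  next
    case (Cons i w)
    then show ?case by (simp add: word_map_Cons S_unit_square)
  qed
  then have W1: "W \<subseteq> unit_square" by (auto simp: W_def)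
  moreover have "closed unit_square" by (metis unit_square_cbox closed_cbox)
  ultimately show "K \<subseteq> unit_square" unfolding K by (simp add: closure_minimal)
  have b: "bounded W" using W1 bounded_subset unit_square_cbox bounded_cbox by metis
  then show c: "compact K" unfolding K by simp
  have "word_map a \<epsilon> [] 0 = 0" by (simp add: word_map_def)
  then have W0: "0 \<in> W" unfolding W_def by (force intro!: image_eqI[of _ _ "[]"])
  then show "0 \<in> K" unfolding K using closure_subset by blast
  then show "K \<noteq> {}" by blast
  have "S 1 0 = 0" by (simp add: vec2_eq_iff ifs_map_component)
  have "W = (\<Union>i\<in>{1..5}. S i ` W)"
  proof
    show "(\<Union>i\<in>{1..5}. S i ` W) \<subseteq> W"
    proof safe
      fix i p assume "i \<in> {1..5::nat}" "p \<in> W"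
      then obtain w where "set w \<subseteq> {1..5}" "p = word_map a \<epsilon> w 0" by (auto simp: W_def)
      then show "S i p \<in> W" using \<open>i \<in> _\<close> unfolding W_def
        by (intro image_eqI[of _ _ "i # w"]) (auto simp: word_map_Cons)
    qed
    show "W \<subseteq> (\<Union>i\<in>{1..5}. S i ` W)"
    proof
      fix p assume "p \<in> W"
      then obtain w where w: "set w \<subseteq> {1..5}" "p = word_map a \<epsilon> w 0" by (auto simp: W_def)
      show "p \<in> (\<Union>i\<in>{1..5}. S i ` W)"
      proof (cases w)
        case Nil
        then have "p = S 1 0" using w \<open>S 1 0 = 0\<close> by (simp add: word_map_def)
        then show ?thesis using W0 by force
      next
        case (Cons i w')
        then have "p = S i (word_map a \<epsilon> w' 0)" "i \<in> {1..5}" "word_map a \<epsilon> w' 0 \<in> W"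
          using w by (auto simp: word_map_Cons W_def)
        then show ?thesis by blast
      qed
    qed
  qed
  then have "K = closure (\<Union>i\<in>{1..5}. S i ` W)" unfolding K by simp
  also have "\<dots> = (\<Union>i\<in>{1..5}. closure (S i ` W))" 
    using atLeastAtMost_1_5 by (simp only: atLeastAtMost_1_5 UN_insert closure_Un closure_empty UN_empty)
  also have "\<dots> = (\<Union>i\<in>{1..5}. S i ` K)"
  proof (intro SUP_cong refl)
    fix i
    show "closure (S i ` W) = S i ` K"
    proof
      have "closed (S i ` K)"
        using c continuous_S by (intro compact_imp_closed compact_continuous_image)
      then show "closure (S i ` W) \<subseteq> S i ` K"
        unfolding K by (intro closure_minimal image_mono closure_subset)
      show "S i ` K \<subseteq> closure (S i ` W)"
        unfolding K using continuous_S by (intro image_closure_subset closure_subset) auto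
    qed
  qed
  finally show "K = (\<Union>i\<in>{1..5}. S i ` K)" .
qed

lemma attractor_properties:
  shows F_nonempty: "F \<noteq> {}" and F_compact: "compact F"
    and F_invariant: "F = (\<Union>i\<in>{1..5}. S i ` F)"
    and F_unit_square: "F \<subseteq> unit_square" and zero_in_F: "0 \<in> F"
proof -
  note K = orbit_closure_invariant
  have "F = closure ((\<lambda>w. word_map a \<epsilon> w 0) ` {w. set w \<subseteq> {1..5}})"
    unfolding attractor_def
  proof (rule the_equality, safe intro!: K(1,2))
  qed (use K compact_invariant_le in blast)+
  then show "F \<noteq> {}" "compact F" "F = (\<Union>i\<in>{1..5}. S i ` F)" "F \<subseteq> unit_square" "0 \<in> F"
    using K by simp_all
qed

lemma S_in_F: "p \<in> F \<Longrightarrow> i \<in> {1..5} \<Longrightarrow> S i p \<in> F"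
  using F_invariant by blast

end

section \<open>Covers, separated sets and box dimension\<close>

definition in_square :: "real \<Rightarrow> real^2 \<Rightarrow> real^2 \<Rightarrow> bool" where
  "in_square \<delta> c p \<longleftrightarrow> c $ 1 \<le> p $ 1 \<and> p $ 1 \<le> c $ 1 + \<delta> \<and> c $ 2 \<le> p $ 2 \<and> p $ 2 \<le> c $ 2 + \<delta>"

lemma cbox_square: "p \<in> cbox c (c + \<delta> *\<^sub>R One) \<longleftrightarrow> in_square \<delta> c p"
  by (auto simp: in_square_def mem_box_cart forall_2)

text \<open>A cover is encoded by the set of lower left corners of its squares; allowing fewer than \<open>n\<close> squares
spares padding when covers are combined.\<close>

definition covered_by :: "nat \<Rightarrow> real \<Rightarrow> (real^2) set \<Rightarrow> bool" where
  "covered_by n \<delta> E \<longleftrightarrow> (\<exists>C :: (real^2) set. finite C \<and> card C \<le> n \<and>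
     (\<forall>p\<in>E. \<exists>c\<in>C. in_square \<delta> c p))"

text \<open>Separation is measured in the supremum norm, so that a square of side \<open>\<delta>\<close> contains at most one
point of a set separated by more than \<open>\<delta>\<close>.\<close>

definition separated :: "real \<Rightarrow> (real^2) set \<Rightarrow> bool" where
  "separated \<delta> P \<longleftrightarrow> finite P \<and> pairwise (\<lambda>p q. \<delta> \<le> infnorm (p - q)) P"

lemma covered_by_mono: "covered_by n \<delta> E \<Longrightarrow> E' \<subseteq> E \<Longrightarrow> n \<le> m \<Longrightarrow> covered_by m \<delta> E'"
  unfolding covered_by_def by (meson order_trans subsetD)

lemma covered_by_Un:
  assumes "covered_by n \<delta> E" "covered_by m \<delta> E'"
  shows "covered_by (n + m) \<delta> (E \<union> E')"
proof -
  obtain C where C: "finite C" "card C \<le> n" "\<forall>p\<in>E. \<exists>c\<in>C. in_square \<delta> c p"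
    using assms(1) unfolding covered_by_def by (elim exE conjE)
  obtain C' where C': "finite C'" "card C' \<le> m" "\<forall>p\<in>E'. \<exists>c\<in>C'. in_square \<delta> c p"
    using assms(2) unfolding covered_by_def by (elim exE conjE)
  show ?thesis unfolding covered_by_def
  proof (intro exI[of _ "C \<union> C'"] conjI)
    show "finite (C \<union> C')" using C C' by simp
    show "card (C \<union> C') \<le> n + m" using card_Un_le[of C C'] C C' by linarith
    show "\<forall>p\<in>E \<union> E'. \<exists>c\<in>C \<union> C'. in_square \<delta> c p"
      using C(3) C'(3) by (metis Un_iff)
  qed
qed

lemma covered_by_singleton: "\<delta> \<ge> 0 \<Longrightarrow> covered_by 1 \<delta> {p}"
  unfolding covered_by_def by (intro exI[of _ "{p}"]) (auto simp: in_square_def)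

lemma covered_by_UN:
  assumes "finite I" "\<And>i. i \<in> I \<Longrightarrow> \<exists>n. real n \<le> B i \<and> covered_by n \<delta> (E i)"
  shows "\<exists>n. real n \<le> (\<Sum>i\<in>I. B i) \<and> covered_by n \<delta> (\<Union>i\<in>I. E i)"
  using assms
proof (induction I rule: finite_induct)
  case empty
  then show ?case by (auto simp: covered_by_def)
next
  case (insert i I)
  then obtain n m where "real n \<le> (\<Sum>i\<in>I. B i)" "covered_by n \<delta> (\<Union>i\<in>I. E i)"
    "real m \<le> B i" "covered_by m \<delta> (E i)"
    by (metis insertCI)
  then show ?case
    using insert.hyps covered_by_Un by (intro exI[of _ "m + n"]) auto
qed

lemma covered_by_box:
  assumes "\<delta> > 0" "w \<ge> 0" "\<And>p. p \<in> E \<Longrightarrow> t \<le> p $ 1 \<and> p $ 1 \<le> t + w \<and> u \<le> p $ 2 \<and> p $ 2 \<le> u + h"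
    and "h \<le> \<delta>"
  shows "\<exists>n. real n \<le> w / \<delta> + 1 \<and> covered_by n \<delta> E"
proof (intro exI conjI)
  define N where "N = nat \<lfloor>w / \<delta>\<rfloor>"
  have N: "real N = of_int \<lfloor>w / \<delta>\<rfloor>" using assms by (simp add: N_def)
  then show "real (Suc N) \<le> w / \<delta> + 1" by (simp add: of_int_floor_le)
  define c :: "nat \<Rightarrow> real^2" where "c k = vector [t + real k * \<delta>, u]" for k
  show "covered_by (Suc N) \<delta> E"
    unfolding covered_by_def
  proof (intro exI[of _ "c ` {..N}"] conjI ballI)
    show "card (c ` {..N}) \<le> Suc N" using card_image_le[of "{..N}" c] by simp
    fix p assume "p \<in> E"
    note p = assms(3)[OF this]
    define k where "k = nat \<lfloor>(p $ 1 - t) / \<delta>\<rfloor>"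
    have k: "real k = of_int \<lfloor>(p $ 1 - t) / \<delta>\<rfloor>" using assms p by (simp add: k_def)
    have "k \<le> N" unfolding k_def N_def
      using p assms by (intro nat_mono floor_mono divide_right_mono) auto
    moreover have "real k \<le> (p $ 1 - t) / \<delta>" "(p $ 1 - t) / \<delta> \<le> real k + 1"
      using k by linarith+
    then have "real k * \<delta> \<le> p $ 1 - t" "p $ 1 - t \<le> (real k + 1) * \<delta>"
      using assms(1) by (simp_all add: field_simps)
    ultimately show "\<exists>c\<in>c ` {..N}. in_square \<delta> c p"
      using p assms by (intro bexI[of _ "c k"]) (auto simp: c_def in_square_def algebra_simps)
  qed simp
qed

lemma covered_by_swap:
  assumes "covered_by n \<delta> ((\<lambda>p. vector [p $ 2, p $ 1]) ` E)"
  shows "covered_by n \<delta> E"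
proof -
  obtain C where C: "finite C" "card C \<le> n"
    "\<forall>p\<in>(\<lambda>p. vector [p $ 2, p $ 1]) ` E. \<exists>c\<in>C. in_square \<delta> c p"
    using assms unfolding covered_by_def by (elim exE conjE)
  let ?C = "(\<lambda>c. vector [c $ 2, c $ 1] :: real^2) ` C"
  show ?thesis unfolding covered_by_def
  proof (intro exI[of _ ?C] conjI)
    show "finite ?C" "card ?C \<le> n" using C card_image_le order_trans by blast+
    show "\<forall>p\<in>E. \<exists>c\<in>?C. in_square \<delta> c p"
      using C(3) by (auto simp: in_square_def)
  qed
qed

lemma covering_number_le:
  assumes "covered_by n \<delta> E"
  shows "covering_number \<delta> E \<le> n"
proof -
  obtain C where C: "finite C" "card C \<le> n"
    "\<forall>p\<in>E. \<exists>c\<in>C. in_square \<delta> c p"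
    using assms unfolding covered_by_def by (elim exE conjE)
  let ?Q = "(\<lambda>c. cbox c (c + \<delta> *\<^sub>R One)) ` C"
  have "covering_number \<delta> E \<le> card ?Q"
    unfolding covering_number_def
    by (rule Least_le, rule exI[of _ ?Q])
      (use C in \<open>auto simp del: real_scaleR_def simp: is_square_def cbox_square subset_iff\<close>)
  also have "\<dots> \<le> n" using C card_image_le order_trans by blast
  finally show ?thesis .
qed

lemma covering_number_ge:
  assumes "covered_by n \<delta> E" "separated \<delta>' P" "\<delta> < \<delta>'" "P \<subseteq> E"
  shows "card P \<le> covering_number \<delta> E"
proof -
  obtain C where C: "finite C"
    "\<forall>p\<in>E. \<exists>c\<in>C. in_square \<delta> c p"
    using assms unfolding covered_by_def by (elim exE conjE)
  let ?ok = "\<lambda>n \<Q>. finite \<Q> \<and> card \<Q> = n \<and> (\<forall>Q\<in>\<Q>. is_square \<delta> Q) \<and> E \<subseteq> \<Union>\<Q>"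
  have "\<exists>\<Q>. ?ok (covering_number \<delta> E) \<Q>"
    unfolding covering_number_def
    by (rule LeastI[where P = "\<lambda>n. \<exists>\<Q>. ?ok n \<Q>"
          and k = "card ((\<lambda>c. cbox c (c + \<delta> *\<^sub>R One)) ` C)"],
        rule exI[of _ "(\<lambda>c. cbox c (c + \<delta> *\<^sub>R One)) ` C"])
      (use C in \<open>auto simp del: real_scaleR_def simp: is_square_def cbox_square subset_iff\<close>)
  then obtain \<Q> where Q: "?ok (covering_number \<delta> E) \<Q>" by blast
  then have "\<forall>p\<in>P. \<exists>Q\<in>\<Q>. p \<in> Q" using assms by blast
  then obtain h where h: "\<And>p. p \<in> P \<Longrightarrow> h p \<in> \<Q> \<and> p \<in> h p" by metis
  have "inj_on h P"
  proof (rule inj_onI, rule ccontr)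
    fix p q assume pq: "p \<in> P" "q \<in> P" "h p = h q" "p \<noteq> q"
    obtain c where "h p = cbox c (c + \<delta> *\<^sub>R One)" using h Q pq unfolding is_square_def by blast
    then have "p \<in> cbox c (c + \<delta> *\<^sub>R One)" "q \<in> cbox c (c + \<delta> *\<^sub>R One)" using h pq by auto
    then have "infnorm (p - q) \<le> \<delta>" by (auto simp: cbox_square in_square_def infnorm_2)
    moreover have "\<delta>' \<le> infnorm (p - q)"
      using assms(2) pq by (auto simp: separated_def pairwise_def)
    ultimately show False using assms(3) by simp
  qed
  then have "card P \<le> card \<Q>" using Q h by (intro card_inj_on_le) auto
  then show ?thesis using Q by simp
qed

lemma separated_UN:
  assumes "finite I" "\<And>i. i \<in> I \<Longrightarrow> separated \<delta> (P i)" "\<delta> > 0"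
    and sep: "\<And>i j p q. i \<in> I \<Longrightarrow> j \<in> I \<Longrightarrow> i \<noteq> j \<Longrightarrow> p \<in> P i \<Longrightarrow> q \<in> P j \<Longrightarrow> \<delta> \<le> infnorm (p - q)"
  shows "separated \<delta> (\<Union>i\<in>I. P i)" "card (\<Union>i\<in>I. P i) = (\<Sum>i\<in>I. card (P i))"
proof -
  show "separated \<delta> (\<Union>i\<in>I. P i)"
    unfolding separated_def pairwise_def
  proof (intro conjI ballI impI)
    show "finite (\<Union>i\<in>I. P i)" using assms(1,2) by (auto simp: separated_def)
    fix p q assume "p \<in> (\<Union>i\<in>I. P i)" "q \<in> (\<Union>i\<in>I. P i)" "p \<noteq> q"
    then obtain i j where ij: "i \<in> I" "j \<in> I" "p \<in> P i" "q \<in> P j" by blast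
    show "\<delta> \<le> infnorm (p - q)"
    proof (cases "i = j")
      case True
      then show ?thesis using assms(2)[of i] ij \<open>p \<noteq> q\<close> by (auto simp: separated_def pairwise_def)
    qed (use sep ij in blast)
  qed
  have "P i \<inter> P j = {}" if "i \<in> I" "j \<in> I" "i \<noteq> j" for i j
    using sep[OF that] assms(3) by (force simp: infnorm_0)
  then show "card (\<Union>i\<in>I. P i) = (\<Sum>i\<in>I. card (P i))"
    using assms(1,2) by (intro card_UN_disjoint) (auto simp: separated_def)
qed

text \<open>A separated set at scale \<open>\<kappa> \<delta>\<close> bounds the covering number at the smaller scale \<open>\<kappa> \<delta> / 2\<close>; the
change of scale and the constants disappear after division by \<open>- ln \<delta>\<close>.\<close>

lemma box_dim_eqI:
  assumes c: "c > 0" "\<kappa> > 0"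
    and upper: "\<And>\<delta>. 0 < \<delta> \<Longrightarrow> \<delta> < 1 \<Longrightarrow> \<exists>n. real n \<le> C * \<delta> powr (-s) \<and> covered_by n \<delta> E"
    and lower: "\<And>\<delta>. 0 < \<delta> \<Longrightarrow> \<delta> < 1 \<Longrightarrow>
      \<exists>P\<subseteq>E. c * \<delta> powr (-s) \<le> real (card P) \<and> separated (\<kappa> * \<delta>) P"
  shows "box_dim E = s"
proof -
  define c' where "c' = c * (2 / \<kappa>) powr (-s)"
  have c': "c' > 0" using c by (simp add: c'_def)
  have ev: "eventually (\<lambda>\<delta>. c' * \<delta> powr (-s) \<le> real (covering_number \<delta> E)
      \<and> real (covering_number \<delta> E) \<le> C * \<delta> powr (-s) \<and> 0 < \<delta> \<and> \<delta> < 1) (at_right 0)"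
  proof -
    have "eventually (\<lambda>\<delta>. \<delta> < min 1 (\<kappa> / 2)) (at_right (0::real))"
      using c by (intro eventually_at_rightI[of 0 "min 1 (\<kappa> / 2)"]; simp)
    moreover have "eventually (\<lambda>\<delta>. \<delta> > 0) (at_right (0::real))" by (rule eventually_at_right_less)
    ultimately show ?thesis
    proof eventually_elim
      case (elim \<delta>)
      then obtain n where n: "real n \<le> C * \<delta> powr (-s)" "covered_by n \<delta> E" using upper[of \<delta>] by auto
      have "2 / \<kappa> * \<delta> < 1" "2 / \<kappa> * \<delta> > 0" using elim c by (auto simp: field_simps)
      from lower[OF this(2,1)] obtain P where
        P: "P \<subseteq> E" "c * (2 / \<kappa> * \<delta>) powr (-s) \<le> real (card P)" "separated (\<kappa> * (2 / \<kappa> * \<delta>)) P" by blast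
      have "card P \<le> covering_number \<delta> E"
        using covering_number_ge[OF n(2) P(3) _ P(1)] elim c by simp
      moreover have "(2 / \<kappa> * \<delta>) powr (-s) = (2 / \<kappa>) powr (-s) * \<delta> powr (-s)"
        by (rule powr_mult)
      ultimately show ?case
        using P(2) n covering_number_le[OF n(2)] elim by (auto simp: c'_def)
    qed
  qed
  have C: "C > 0"
  proof -
    obtain \<delta> :: real where d: "c' * \<delta> powr (-s) \<le> real (covering_number \<delta> E)"
        "real (covering_number \<delta> E) \<le> C * \<delta> powr (-s)" "0 < \<delta>"
      using eventually_happens[OF ev] by auto
    then have "c' * \<delta> powr (-s) \<le> C * \<delta> powr (-s)" by linarith
    then show ?thesis using c' d(3) by (simp add: mult_le_cancel_right)
  qed
  have lim: "((\<lambda>\<delta>. (ln K - s * ln \<delta>) / (- ln \<delta>)) \<longlongrightarrow> s) (at_right 0)" for K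
  proof -
    have "filterlim (\<lambda>\<delta>::real. ln \<delta>) at_infinity (at_right 0)"
      using ln_at_0 by (rule filterlim_mono) (simp_all add: at_bot_le_at_infinity)
    then have "((\<lambda>\<delta>. s - ln K / ln \<delta>) \<longlongrightarrow> s - 0) (at_right 0)"
      by (intro tendsto_diff tendsto_const tendsto_divide_0[OF tendsto_const])
    moreover have "eventually (\<lambda>\<delta>. s - ln K / ln \<delta> = (ln K - s * ln \<delta>) / (- ln \<delta>)) (at_right 0)"
      using ev by eventually_elim (auto simp: field_simps)
    ultimately show ?thesis by (simp add: tendsto_cong)
  qed
  have "((\<lambda>\<delta>. ln (real (covering_number \<delta> E)) / (- ln \<delta>)) \<longlongrightarrow> s) (at_right 0)"
  proof (rule tendsto_sandwich[OF _ _ lim[of c'] lim[of C]])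
    have *: "ln (K * \<delta> powr (-s)) = ln K - s * ln \<delta>" if "K > 0" "\<delta> > 0" for K \<delta> :: real
      using that by (simp add: ln_mult ln_powr)
    show "eventually (\<lambda>\<delta>. (ln c' - s * ln \<delta>) / (- ln \<delta>) \<le> ln (real (covering_number \<delta> E)) / (- ln \<delta>)) (at_right 0)"
      using ev
    proof eventually_elim
      case (elim \<delta>)
      then have "c' * \<delta> powr (-s) > 0" using c' by simp
      then have "ln (c' * \<delta> powr (-s)) \<le> ln (real (covering_number \<delta> E))"
        using elim by (intro ln_mono) auto
      then show ?case using elim c' * by (intro divide_right_mono) auto
    qed
    show "eventually (\<lambda>\<delta>. ln (real (covering_number \<delta> E)) / (- ln \<delta>) \<le> (ln C - s * ln \<delta>) / (- ln \<delta>)) (at_right 0)"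
      using ev
    proof eventually_elim
      case (elim \<delta>)
      then have "c' * \<delta> powr (-s) > 0" using c' by simp
      then have "ln (real (covering_number \<delta> E)) \<le> ln (C * \<delta> powr (-s))"
        using elim by (intro ln_mono) auto
      then show ?case using elim C * by (intro divide_right_mono) auto
    qed
  qed
  then show ?thesis unfolding box_dim_def by (intro tendsto_Lim trivial_limit_at_right_real)
qed

section \<open>Projections for positive parameter\<close>

locale carpet_pos = carpet +
  assumes eps_pos: "\<epsilon> > 0"
begin

lemma F_coord_bounds: "p \<in> F \<Longrightarrow> 0 \<le> p $ j \<and> p $ j \<le> 1"
  using F_unit_square exhaust_2[of j] by (auto simp: unit_square_def)

text \<open>The vertical projection \<open>K\<close> of the attractor is mapped into itself by \<open>y \<mapsto> (y + j) / 3\<close> for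
\<open>j = 0, 1, 2\<close>, and these three maps cover \<open>[0,1]\<close>.  A point of \<open>[0,1]\<close> farthest from \<open>K\<close> is the image of a point
at least three times as far from \<open>K\<close>, so the distance is 0.\<close>

lemma F_second_coord: "0 \<le> y \<Longrightarrow> y \<le> 1 \<Longrightarrow> \<exists>p\<in>F. p $ 2 = y"
proof -
  define K where "K = (\<lambda>p. p $ 2) ` F"
  have K: "compact K" "K \<noteq> {}"
    unfolding K_def using F_compact F_nonempty
    by (auto intro!: compact_continuous_image continuous_intros)
  have "\<exists>z\<in>{0..1}. \<forall>x\<in>{0..1}. infdist x K \<le> infdist z K"
    by (intro continuous_attains_sup) (auto intro: continuous_intros)
  then obtain z where z: "0 \<le> z" "z \<le> 1" "\<And>x. 0 \<le> x \<Longrightarrow> x \<le> 1 \<Longrightarrow> infdist x K \<le> infdist z K"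
    by auto
  define j :: nat where "j = (if z < 1/3 then 1 else if z < 2/3 then 2 else 3)"
  define z' where "z' = 3 * z - (real j - 1)"
  have z': "0 \<le> z'" "z' \<le> 1" using z by (auto simp: z'_def j_def)
  obtain k where k: "k \<in> K" "infdist z' K = dist z' k"
    using infdist_attains_inf[of K z'] K by (auto simp: compact_imp_closed)
  obtain r where r: "r \<in> F" "k = r $ 2" using k K_def by auto
  have "S j r \<in> F" using r by (intro S_in_F) (auto simp: j_def)
  then have "S j r $ 2 \<in> K" by (auto simp: K_def)
  then have "infdist z K \<le> dist z (S j r $ 2)" by (rule infdist_le)
  also have "S j r $ 2 = (k + (real j - 1)) / 3"
    using r by (auto simp: ifs_map_component j_def add_divide_distrib)
  also have "dist z \<dots> = dist z' k / 3"
  proof -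
    have "z - (k + (real j - 1)) / 3 = (z' - k) / 3" by (simp add: z'_def field_simps)
    then have "\<bar>z - (k + (real j - 1)) / 3\<bar> = \<bar>z' - k\<bar> / 3" by (simp only: abs_divide abs_numeral)
    then show ?thesis by (simp only: dist_real_def)
  qed
  also have "\<dots> \<le> infdist z K / 3" using z(3)[OF z'] k by simp
  finally have "infdist z K \<le> 0" by simp
  then have "infdist y K = 0" if "0 \<le> y" "y \<le> 1" for y
    using z(3)[OF that] infdist_nonneg[of y K] by linarith
  then show "0 \<le> y \<Longrightarrow> y \<le> 1 \<Longrightarrow> \<exists>p\<in>F. p $ 2 = y"
    using in_closed_iff_infdist_zero[of K y] K by (auto simp: compact_imp_closed K_def)
qed

text \<open>Here \<open>S\<^sub>5\<close> turns the full vertical projection into an interval of the horizontal one.  This is what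
fails at \<open>\<epsilon> = 0\<close>.\<close>

lemma F_first_coord: "0 \<le> y \<Longrightarrow> y \<le> 1 \<Longrightarrow> \<exists>p\<in>F. p $ 1 = \<epsilon> * y + 9/10"
  using F_second_coord[of y] S_in_F[of _ 5] by (force simp: ifs_map_component)

text \<open>For \<open>N = 0\<close> the separation reads \<open>0 \<le> \<dots>\<close> because of \<open>\<epsilon> / 0 = 0\<close>.\<close>

lemma points_along_axis:
  "\<exists>P\<subseteq>F. finite P \<and> card P = Suc N \<and> (\<forall>p\<in>P. \<forall>q\<in>P. p \<noteq> q \<longrightarrow> \<epsilon> / real N \<le> \<bar>p $ j - q $ j\<bar>)"
proof -
  obtain l c where l: "l \<ge> \<epsilon>" "\<And>y. 0 \<le> y \<Longrightarrow> y \<le> 1 \<Longrightarrow> \<exists>p\<in>F. p $ j = l * y + c"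
  proof (cases "j = 1")
    case True
    then show ?thesis using F_first_coord that[of \<epsilon> "9/10"] by blast
  next
    case False
    then have "j = 2" using exhaust_2[of j] by blast
    then show ?thesis using F_second_coord that[of 1 0] eps by auto
  qed
  have "\<exists>p\<in>F. p $ j = l * (real k / real N) + c" if "k \<le> N" for k
    using that by (intro l(2)) (auto simp: divide_le_eq)
  then obtain g where g: "\<And>k. k \<le> N \<Longrightarrow> g k \<in> F \<and> g k $ j = l * (real k / real N) + c"
    by metis
  have sep: "\<epsilon> / real N \<le> \<bar>g k $ j - g m $ j\<bar>" if "k \<le> N" "m \<le> N" "k \<noteq> m" for k m
  proof -
    have N: "N > 0" using that by linarith
    have "g k $ j - g m $ j = (real k - real m) * (l / real N)"
      using g that(1,2) by (simp add: algebra_simps diff_divide_distrib)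
    then have *: "\<bar>g k $ j - g m $ j\<bar> = \<bar>real k - real m\<bar> * (l / real N)"
      using l eps_pos by (simp add: abs_mult)
    have "1 \<le> \<bar>real k - real m\<bar>" using that(3) by linarith
    moreover have "\<epsilon> / real N \<le> l / real N" using l(1) by (rule divide_right_mono) simp
    moreover have "\<epsilon> / real N \<ge> 0" using eps_pos by simp
    ultimately have "1 * (\<epsilon> / real N) \<le> \<bar>real k - real m\<bar> * (l / real N)"
      by (intro mult_mono) auto
    then show ?thesis using * by simp
  qed
  have "inj_on g {..N}"
  proof (rule inj_onI, rule ccontr)
    fix k m assume "k \<in> {..N}" "m \<in> {..N}" "g k = g m" "k \<noteq> m"
    then have "N > 0" "\<epsilon> / real N \<le> 0" using sep[of k m] by auto
    then show False using eps_pos by (simp add: field_simps)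
  qed
  then have "card (g ` {..N}) = Suc N" by (simp add: card_image)
  then show ?thesis
  proof (intro exI[of _ "g ` {..N}"] conjI ballI impI)
    fix u v assume uv: "u \<in> g ` {..N}" "v \<in> g ` {..N}" "u \<noteq> v"
    then obtain k m where "k \<le> N" "m \<le> N" "u = g k" "v = g m" by blast
    then show "\<epsilon> / real N \<le> \<bar>u $ j - v $ j\<bar>" using sep[of k m] uv(3) by blast
  qed (use g in auto)
qed

lemma box_dim_projection: "box_dim (axis_projection j ` F) = 1"
proof (rule box_dim_eqI[of 1 \<epsilon> 2])
  fix \<delta> :: real assume d: "0 < \<delta>" "\<delta> < 1"
  then have pw: "\<delta> powr - 1 = 1 / \<delta>" by (simp add: powr_minus_divide)
  have bound: "1 / \<delta> + 1 \<le> 2 * \<delta> powr - 1" using d pw by (simp add: field_simps)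
  have "\<exists>n. real n \<le> 1 / \<delta> + 1 \<and> covered_by n \<delta> (axis_projection j ` F)"
  proof (cases "j = 1")
    case True
    then show ?thesis
      using d F_coord_bounds by (intro covered_by_box[of _ _ _ 0 0 0]) (auto simp: axis_projection_def axis_def)
  next
    case False
    then have j: "j = 2" using exhaust_2[of j] by blast
    have "\<exists>n. real n \<le> 1 / \<delta> + 1 \<and> covered_by n \<delta> ((\<lambda>p. vector [p $ 2, p $ 1]) ` axis_projection j ` F)"
      using d F_coord_bounds j
      by (intro covered_by_box[of _ _ _ 0 0 0]) (auto simp: axis_projection_def axis_def)
    then show ?thesis using covered_by_swap by blast
  qed
  then show "\<exists>n. real n \<le> 2 * \<delta> powr - 1 \<and> covered_by n \<delta> (axis_projection j ` F)"
    using bound order_trans by blast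
  define N where "N = nat \<lfloor>1 / \<delta>\<rfloor>"
  have N: "real N \<le> 1 / \<delta>" "1 / \<delta> \<le> real (Suc N)" "N > 0"
    using d unfolding N_def by (simp_all, linarith)
  obtain P where P: "P \<subseteq> F" "finite P" "card P = Suc N"
    "\<And>p q. p \<in> P \<Longrightarrow> q \<in> P \<Longrightarrow> p \<noteq> q \<Longrightarrow> \<epsilon> / real N \<le> \<bar>p $ j - q $ j\<bar>"
    using points_along_axis[of N j] by blast
  have "infnorm (axis_projection j p - axis_projection j q) = \<bar>p $ j - q $ j\<bar>" for p q
    using exhaust_2[of j] by (auto simp: infnorm_2 axis_projection_def axis_def)
  moreover have "\<epsilon> * \<delta> \<le> \<epsilon> / real N" using N d eps_pos by (simp add: field_simps)
  ultimately have sep: "\<epsilon> * \<delta> \<le> infnorm (axis_projection j p - axis_projection j q)"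
    if "p \<in> P" "q \<in> P" "p \<noteq> q" for p q using P(4)[OF that] by simp
  have "inj_on (axis_projection j) P"
  proof (rule inj_onI, rule ccontr)
    fix p q assume "p \<in> P" "q \<in> P" "axis_projection j p = axis_projection j q" "p \<noteq> q"
    then have "\<epsilon> * \<delta> \<le> 0" using sep[of p q] by (simp add: infnorm_0)
    then show False using eps_pos d by (simp add: mult_le_0_iff)
  qed
  then have card: "card (axis_projection j ` P) = Suc N" using P by (simp add: card_image)
  have "separated (\<epsilon> * \<delta>) (axis_projection j ` P)"
    unfolding separated_def pairwise_def
  proof (intro conjI ballI impI)
    fix u v assume uv: "u \<in> axis_projection j ` P" "v \<in> axis_projection j ` P" "u \<noteq> v"
    then obtain p q where "p \<in> P" "q \<in> P" "u = axis_projection j p" "v = axis_projection j q"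
      by blast
    then show "\<epsilon> * \<delta> \<le> infnorm (u - v)" using sep[of p q] uv(3) by blast
  qed (use P(2) in simp)
  moreover have "1 * \<delta> powr - 1 \<le> real (card (axis_projection j ` P))"
    unfolding card pw using N(2) by simp
  ultimately show "\<exists>P\<subseteq>axis_projection j ` F. 1 * \<delta> powr - 1 \<le> real (card P) \<and> separated (\<epsilon> * \<delta>) P"
    using P(1) by blast
qed (use eps_pos in auto)

lemma p1_eq_1: "p1 a \<epsilon> w = 1"
  by (simp add: p1_def box_dim_projection)

end

section \<open>Box dimension for positive parameter\<close>

text \<open>For the singular values \<open>max x y\<close> and \<open>min x y\<close> the right-hand side separates a factor that depends
on the larger one only from a power of the determinant, which is multiplicative.\<close>

lemma max_times_min_powr:
  fixes x y s :: real
  assumes "x > 0" "y > 0"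
  shows "max x y * min x y powr (s - 1) = max x y powr (2 - s) * (x * y) powr (s - 1)"
proof -
  have "x * y = max x y * min x y" by (auto simp: max_def min_def)
  then have "(x * y) powr (s - 1) = max x y powr (s - 1) * min x y powr (s - 1)"
    by (simp add: powr_mult)
  moreover have "max x y powr (2 - s) * max x y powr (s - 1) = max x y"
    using assms by (simp add: powr_add[symmetric])
  ultimately show ?thesis by (metis mult.assoc)
qed

text \<open>The two equations say that \<open>(p, q)\<close> is an eigenvector, for the eigenvalue 1, of the symmetric matrix
with diagonal entries \<open>4 a 3\<^sup>1\<^sup>-\<^sup>s\<close> and \<open>4 a\<^sup>s\<^sup>-\<^sup>1 / 3\<close> and off-diagonal entry \<open>\<epsilon>\<^sup>s\<close>.  A suitable
\<open>s\<close> is found in \<open>box_dim_F_gt\<close>.\<close>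

locale carpet_weight = carpet_pos +
  fixes s p q :: real
  assumes s: "1 < s" "s < 2" and pq: "p > 0" "q > 0"
    and eigen: "4 * a * (1/3) powr (s - 1) * p + \<epsilon> powr s * q = p"
      "4 * (1/3) * a powr (s - 1) * q + \<epsilon> powr s * p = q"
begin

definition \<phi> :: "real \<Rightarrow> real \<Rightarrow> real" where
  "\<phi> x y = (p * x powr (2 - s) + q * y powr (2 - s)) * (x * y) powr (s - 1)"

text \<open>A rectangle with columns \<open>x, y\<close> has four children with columns \<open>x a, y / 3\<close> and one, coming from
\<open>S\<^sub>5\<close>, with columns \<open>y \<epsilon>, x \<epsilon>\<close>; the latter exchange couples the two terms of \<open>\<phi>\<close>.\<close>

lemma weight_conserved:
  assumes "x > 0" "y > 0"
  shows "4 * \<phi> (x * a) (y / 3) + \<phi> (y * \<epsilon>) (x * \<epsilon>) = \<phi> x y"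
proof -
  have pos: "a > 0" "\<epsilon> > 0" using a eps_pos by auto
  have a1: "a powr (2 - s) * a powr (s - 1) = a" 
    using pos by (simp add: powr_add[symmetric])
  have t1: "(1/3 :: real) powr (2 - s) * (1/3) powr (s - 1) = 1/3"
    by (simp add: powr_add[symmetric])
  have e1: "\<epsilon> powr (2 - s) * (\<epsilon> powr (s - 1) * \<epsilon> powr (s - 1)) = \<epsilon> powr s"
    by (simp add: powr_add[symmetric])
  define X where "X = x powr (2 - s)"
  define Y where "Y = y powr (2 - s)"
  define Z where "Z = x powr (s - 1) * y powr (s - 1)"
  have y3: "y / 3 = y * (1/3)" by simp
  have "4 * \<phi> (x * a) (y / 3) = 
      p * X * Z * (4 * (a powr (2 - s) * a powr (s - 1)) * (1/3) powr (s - 1))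
      + q * Y * Z * (4 * ((1/3) powr (2 - s) * (1/3) powr (s - 1)) * a powr (s - 1))"
    unfolding \<phi>_def y3 using assms pos
    by (simp only: powr_mult X_def Y_def Z_def distrib_left distrib_right mult_ac)
  also have "\<dots> = X * Z * (4 * a * (1/3) powr (s - 1) * p) + Y * Z * (4 * (1/3) * a powr (s - 1) * q)"
    unfolding a1 t1 by (simp add: algebra_simps)
  finally have A: "4 * \<phi> (x * a) (y / 3) = \<dots>" .
  have "\<phi> (y * \<epsilon>) (x * \<epsilon>) = (p * Y * Z + q * X * Z) * (\<epsilon> powr (2 - s) * (\<epsilon> powr (s - 1) * \<epsilon> powr (s - 1)))"
    unfolding \<phi>_def using assms pos
    by (simp only: powr_mult X_def Y_def Z_def distrib_left distrib_right mult_ac)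
  also have "\<dots> = (p * Y * Z + q * X * Z) * \<epsilon> powr s" unfolding e1 ..
  finally have B: "\<phi> (y * \<epsilon>) (x * \<epsilon>) = \<dots>" .
  have "4 * \<phi> (x * a) (y / 3) + \<phi> (y * \<epsilon>) (x * \<epsilon>)
    = X * Z * (4 * a * (1/3) powr (s - 1) * p + \<epsilon> powr s * q)
     + Y * Z * (4 * (1/3) * a powr (s - 1) * q + \<epsilon> powr s * p)"
    unfolding A B by (simp add: algebra_simps)
  also have "\<dots> = \<phi> x y"
    unfolding eigen \<phi>_def using assms by (simp add: powr_mult X_def Y_def Z_def algebra_simps)
  finally show ?thesis .
qed

text \<open>So \<open>\<phi>\<close> is comparable to \<open>\<alpha>\<^sub>1 \<alpha>\<^sub>2\<^sup>s\<^sup>-\<^sup>1\<close>.  For a rectangle of short side about \<open>\<delta>\<close> this is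
\<open>\<delta>\<^sup>s\<close> times \<open>\<alpha>\<^sub>1 / \<delta>\<close>, the number of squares of side \<open>\<delta>\<close> that it needs.\<close>

lemma weight_bounds:
  assumes "x > 0" "y > 0"
  shows "min p q * max x y * min x y powr (s - 1) \<le> \<phi> x y"
    and "\<phi> x y \<le> (p + q) * max x y * min x y powr (s - 1)"
proof -
  note * = max_times_min_powr[OF assms, of s]
  have le: "x powr (2 - s) \<le> max x y powr (2 - s)" "y powr (2 - s) \<le> max x y powr (2 - s)"
    using s assms by (auto intro!: powr_mono2)
  have "min p q * max x y powr (2 - s) \<le> p * x powr (2 - s) + q * y powr (2 - s)"
  proof (cases "x \<le> y")
    case True
    then have "min p q * max x y powr (2 - s) \<le> q * y powr (2 - s)"
      by (intro mult_mono) (use pq in \<open>auto simp: max_def\<close>)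
    moreover have "p * x powr (2 - s) \<ge> 0" using pq by simp
    ultimately show ?thesis by linarith
  next
    case False
    then have "min p q * max x y powr (2 - s) \<le> p * x powr (2 - s)"
      by (intro mult_mono) (use pq in \<open>auto simp: max_def\<close>)
    moreover have "q * y powr (2 - s) \<ge> 0" using pq by simp
    ultimately show ?thesis by linarith
  qed
  then show "min p q * max x y * min x y powr (s - 1) \<le> \<phi> x y"
    unfolding \<phi>_def mult.assoc * by (subst mult.assoc[symmetric], intro mult_right_mono) auto
  have "p * x powr (2 - s) + q * y powr (2 - s) \<le> (p + q) * max x y powr (2 - s)"
    unfolding distrib_right using le pq by (intro add_mono mult_left_mono) auto
  then show "\<phi> x y \<le> (p + q) * max x y * min x y powr (s - 1)"
    unfolding \<phi>_def mult.assoc * by (subst mult.assoc[symmetric], intro mult_right_mono) auto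
qed

lemma image_F_split: "f ` F = (\<Union>i\<in>{1..5}. (f \<circ> S i) ` F)"
proof -
  have "f ` F = f ` (\<Union>i\<in>{1..5}. S i ` F)" using F_invariant by simp
  then show ?thesis by (simp add: image_UN image_comp)
qed

lemma sum_children:
  assumes "x > 0" "y > 0"
  shows "(\<Sum>i\<in>{1..5::nat}. if i = 5 then \<phi> (y * \<epsilon>) (x * \<epsilon>) else \<phi> (x * a) (y / 3)) = \<phi> x y"
  using weight_conserved[OF assms] unfolding atLeastAtMost_1_5 by simp

text \<open>One subdivision multiplies each side by a factor between \<open>\<epsilon>\<close> and \<open>1/2\<close>.  So a process that stops once
the short side is at most \<open>\<delta>\<close> stops with a short side of at least \<open>\<epsilon> \<delta>\<close>, after a bounded number of steps.\<close>

lemma child_affine: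
  assumes "axis_affine f x y" "i \<in> {1..5}" "x > 0" "y > 0" "\<delta> > 0" 
    and "\<delta> < min x y" "max x y \<le> 2 ^ Suc n * \<delta>"
  obtains x' y' where "axis_affine (f \<circ> S i) x' y'" "x' > 0" "y' > 0"
    "\<epsilon> * \<delta> \<le> min x' y'" "max x' y' \<le> 2 ^ n * \<delta>"
    "\<phi> x' y' = (if i = 5 then \<phi> (y * \<epsilon>) (x * \<epsilon>) else \<phi> (x * a) (y / 3))"
proof -
  have d: "\<delta> \<le> x" "\<delta> \<le> y" and m: "x * (1/2) \<le> 2 ^ n * \<delta>" "y * (1/2) \<le> 2 ^ n * \<delta>"
    using assms(6,7) by auto
  have shrink: "\<epsilon> * \<delta> \<le> z * c \<and> z * c \<le> 2 ^ n * \<delta> \<and> 0 < z * c"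
    if "\<epsilon> \<le> c" "c \<le> 1/2" "z = x \<or> z = y" for c z
  proof -
    have z: "\<delta> \<le> z" "z * (1/2) \<le> 2 ^ n * \<delta>" "z > 0" using that(3) d m assms(3,4) by auto
    have "\<delta> * \<epsilon> \<le> z * c" using z that eps_pos assms(5) by (intro mult_mono) auto
    moreover have "z * c \<le> z * (1/2)" using z that by (intro mult_left_mono) auto
    moreover have "0 < z * c" using z that(1) eps_pos by simp
    ultimately show ?thesis using z(2) by (auto simp only: mult.commute[of \<delta> \<epsilon>])
  qed
  show ?thesis
  proof (cases "i = 5")
    case True
    have "\<epsilon> \<le> 1/2" using eps by simp
    then show ?thesis
      using that[of "y * \<epsilon>" "x * \<epsilon>"] axis_affine_comp_ifs_map(2)[OF assms(1)] True
        shrink[of \<epsilon> x] shrink[of \<epsilon> y] by simp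
  next
    case False
    then have "i \<in> {1..4}" using assms(2) by auto
    have "\<epsilon> \<le> a" "a \<le> 1/2" "\<epsilon> \<le> 1/3" using eps a by auto
    then show ?thesis
      using that[of "x * a" "y / 3"] axis_affine_comp_ifs_map(1)[OF assms(1) \<open>i \<in> {1..4}\<close>] False
        shrink[of a x] shrink[of "1/3" y] by simp
  qed
qed

lemma affine_image_cover:
  assumes "axis_affine f x y" "x > 0" "y > 0" "\<delta> > 0" "min x y \<le> \<delta>"
  shows "\<exists>N. real N \<le> max x y / \<delta> + 1 \<and> covered_by N \<delta> (f ` F)"
proof -
  obtain t u where f: "(\<forall>v. f v $ 1 = x * v $ 1 + t \<and> f v $ 2 = y * v $ 2 + u) \<or>
     (\<forall>v. f v $ 1 = y * v $ 2 + t \<and> f v $ 2 = x * v $ 1 + u)"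
    using assms(1) unfolding axis_affine_def by blast
  define w h where "w = (if (\<forall>v. f v $ 1 = x * v $ 1 + t \<and> f v $ 2 = y * v $ 2 + u) then x else y)"
    and "h = (if (\<forall>v. f v $ 1 = x * v $ 1 + t \<and> f v $ 2 = y * v $ 2 + u) then y else x)"
  have wh: "max w h = max x y" "min w h = min x y" "w > 0" "h > 0"
    using assms by (auto simp: w_def h_def)
  have b: "0 \<le> c * v $ j \<and> c * v $ j \<le> c" if "v \<in> F" "c > 0" for c :: real and v j
    using F_coord_bounds[OF that(1), of j] that(2) by (auto simp: mult_left_le)
  have B: "t \<le> z $ 1 \<and> z $ 1 \<le> t + w \<and> u \<le> z $ 2 \<and> z $ 2 \<le> u + h" if z: "z \<in> f ` F" for z
  proof -
    obtain v where v: "v \<in> F" "z = f v" using z by blast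
    have "0 \<le> x * v $ 1 \<and> x * v $ 1 \<le> x" "0 \<le> y * v $ 2 \<and> y * v $ 2 \<le> y"
      using b v assms by blast+
    then show ?thesis using f v unfolding w_def h_def by (auto split: if_splits)
  qed
  show ?thesis
  proof (cases "h \<le> \<delta>")
    case True
    then obtain N where N: "real N \<le> w / \<delta> + 1" "covered_by N \<delta> (f ` F)"
      using covered_by_box[OF assms(4) less_imp_le[OF wh(3)], of "f ` F" t u h] B by blast
    have "w / \<delta> \<le> max x y / \<delta>" using wh(1) assms(4) by (intro divide_right_mono) linarith+
    then show ?thesis using N by (intro exI[of _ N]) linarith
  next
    case False
    then have "w \<le> \<delta>" using wh(2) assms(5) by linarith
    have B2: "u \<le> z $ 1 \<and> z $ 1 \<le> u + h \<and> t \<le> z $ 2 \<and> z $ 2 \<le> t + w"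
      if "z \<in> (\<lambda>p. vector [p $ 2, p $ 1]) ` f ` F" for z :: "real^2"
    proof -
      from that obtain v where "v \<in> f ` F" "z = vector [v $ 2, v $ 1]" by (rule imageE) simp
      then show ?thesis using B by simp
    qed
    obtain N where N: "real N \<le> h / \<delta> + 1" "covered_by N \<delta> ((\<lambda>p. vector [p $ 2, p $ 1]) ` f ` F)"
      using covered_by_box[where h = w and t = u and u = t, OF assms(4) less_imp_le[OF wh(4)] B2 \<open>w \<le> \<delta>\<close>,
          of "(\<lambda>p. vector [p $ 2, p $ 1]) ` f ` F"] by blast
    have "h / \<delta> \<le> max x y / \<delta>" using wh(1) assms(4) by (intro divide_right_mono) linarith+
    then have "real N \<le> max x y / \<delta> + 1" using N(1) by linarith
    then show ?thesis using covered_by_swap[OF N(2)] by (intro exI[of _ N] conjI)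
  qed
qed

text \<open>Subdivide until the short side is at most \<open>\<delta>\<close>.  There the number of squares needed is proportional to
\<open>\<phi>\<close> by \<open>weight_bounds\<close>, and conservation of \<open>\<phi>\<close> carries the estimate back to the initial rectangle
without loss of constants.  The induction is over all axis-parallel maps, so that no set of stopped words
has to be described.\<close>

lemma cover_image:
  fixes \<delta> :: real
  defines "C \<equiv> (1 + 1 / \<epsilon>) / (min p q * \<epsilon> powr (s - 1))"
  assumes "axis_affine f x y" "x > 0" "y > 0" "\<delta> > 0"
    and "\<epsilon> * \<delta> \<le> min x y" "max x y \<le> 2 ^ n * \<delta>"
  shows "\<exists>N. real N \<le> C * \<delta> powr (-s) * \<phi> x y \<and> covered_by N \<delta> (f ` F)"
  using assms(2-)
proof (induction n arbitrary: f x y)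
  have stop: "\<exists>N. real N \<le> C * \<delta> powr (-s) * \<phi> x y \<and> covered_by N \<delta> (f ` F)"
    if h: "axis_affine f x y" "x > 0" "y > 0" "\<delta> > 0" "\<epsilon> * \<delta> \<le> min x y" "min x y \<le> \<delta>" for f x y
  proof -
    obtain N where N: "real N \<le> max x y / \<delta> + 1" "covered_by N \<delta> (f ` F)"
      using affine_image_cover[OF h(1-4,6)] by blast
    have "\<epsilon> * \<delta> \<le> max x y" using h by auto
    then have "1 \<le> max x y / (\<epsilon> * \<delta>)" using h eps_pos by (simp add: field_simps)
    then have N1: "real N \<le> (1 + 1 / \<epsilon>) * (max x y / \<delta>)" 
    proof -
      have "(1 + 1 / \<epsilon>) * (max x y / \<delta>) = max x y / \<delta> + max x y / \<delta> / \<epsilon>"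
        by (simp add: distrib_right add_divide_distrib)
      then show ?thesis using N(1) \<open>1 \<le> max x y / (\<epsilon> * \<delta>)\<close> by (simp add: mult.commute)
    qed
    have "(\<epsilon> * \<delta>) powr (s - 1) \<le> min x y powr (s - 1)"
      using h eps_pos s by (intro powr_mono2) auto
    then have "min p q * max x y * (\<epsilon> * \<delta>) powr (s - 1) \<le> min p q * max x y * min x y powr (s - 1)"
      using pq h by (intro mult_left_mono) (auto simp: max_def)
    also have "\<dots> \<le> \<phi> x y" by (rule weight_bounds[OF h(2,3)])
    finally have 1: "min p q * \<epsilon> powr (s - 1) * \<delta> powr (s - 1) * max x y \<le> \<phi> x y"
      by (simp add: powr_mult algebra_simps)
    have mp: "min p q * \<epsilon> powr (s - 1) > 0" using pq eps_pos by simp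
    have "\<delta> powr (s - 1) * \<delta> powr (-s) = \<delta> powr (-1)" by (simp add: powr_add[symmetric])
    also have "\<dots> = 1 / \<delta>" using h(4) by (simp add: powr_minus_divide)
    finally have d: "\<delta> powr (s - 1) * \<delta> powr (-s) = 1 / \<delta>" .
    have "min p q * \<epsilon> powr (s - 1) * (max x y / \<delta>)
        = min p q * \<epsilon> powr (s - 1) * max x y * (\<delta> powr (s - 1) * \<delta> powr (-s))"
      unfolding d by simp
    also have "\<dots> = min p q * \<epsilon> powr (s - 1) * \<delta> powr (s - 1) * max x y * \<delta> powr (-s)"
      by (simp only: mult_ac)
    also have "\<dots> \<le> \<phi> x y * \<delta> powr (-s)" using 1 by (intro mult_right_mono) auto
    finally have "max x y / \<delta> \<le> \<phi> x y * \<delta> powr (-s) / (min p q * \<epsilon> powr (s - 1))"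
      using mp by (simp only: pos_le_divide_eq) (simp add: mult_ac)
    then have "(1 + 1 / \<epsilon>) * (max x y / \<delta>)
        \<le> (1 + 1 / \<epsilon>) * (\<phi> x y * \<delta> powr (-s) / (min p q * \<epsilon> powr (s - 1)))"
      using eps_pos by (intro mult_left_mono) auto
    also have "\<dots> = C * \<delta> powr (-s) * \<phi> x y" unfolding C_def by simp
    finally show ?thesis using N N1 by force
  qed
  {
    case (0 f x y)
    then show ?case by (intro stop) auto
  next
    case (Suc n f x y)
    show ?case
    proof (cases "min x y \<le> \<delta>")
      case True
      then show ?thesis using Suc.prems by (intro stop) auto
    next
      case False
      let ?w = "\<lambda>i::nat. if i = 5 then \<phi> (y * \<epsilon>) (x * \<epsilon>) else \<phi> (x * a) (y / 3)"
      have "\<exists>N. real N \<le> C * \<delta> powr (-s) * ?w i \<and> covered_by N \<delta> ((f \<circ> S i) ` F)"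
        if i: "i \<in> {1..5}" for i
      proof -
        have "\<delta> < min x y" using False by (simp only: not_le)
        from child_affine[OF Suc.prems(1) i Suc.prems(2,3,4) this Suc.prems(6)]
        obtain x' y' where xy: "axis_affine (f \<circ> S i) x' y'" "x' > 0" "y' > 0"
          "\<epsilon> * \<delta> \<le> min x' y'" "max x' y' \<le> 2 ^ n * \<delta>" "\<phi> x' y' = ?w i" by blast
        show ?thesis
          using Suc.IH[OF xy(1-3) Suc.prems(4) xy(4,5)] unfolding xy(6) .
      qed
      from covered_by_UN[OF finite_atLeastAtMost this] have "\<exists>N. real N \<le> (\<Sum>i\<in>{1..5}. C * \<delta> powr (-s) * ?w i)
          \<and> covered_by N \<delta> (f ` F)"
        unfolding image_F_split[of f] .
      then show ?thesis
        unfolding sum_distrib_left[symmetric] sum_children[OF Suc.prems(2,3)] .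
    qed
  }
qed

definition open_unit_square :: "(real^2) set" where
  "open_unit_square = {v. 0 < v $ 1 \<and> v $ 1 < 1 \<and> 0 < v $ 2 \<and> v $ 2 < 1}"

lemma S_open_unit_square:
  assumes "v \<in> open_unit_square" "i \<in> {1..5}"
  shows "S i v \<in> open_unit_square"
proof -
  have "0 < a * v $ 1" "a * v $ 1 < a * 1" "\<epsilon> * v $ 1 > 0" "\<epsilon> * v $ 1 < \<epsilon> * 1"
    "\<epsilon> * v $ 2 > 0" "\<epsilon> * v $ 2 < \<epsilon> * 1"
    using a eps_pos assms(1) by (auto simp: open_unit_square_def)
  then have "0 < a * v $ 1" "a * v $ 1 < a" "\<epsilon> * v $ 1 > 0" "\<epsilon> * v $ 1 < 1/10"
    "\<epsilon> * v $ 2 > 0" "\<epsilon> * v $ 2 < 1/10"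
    using eps by linarith+
  moreover have "a * v $ 1 < 1" "0 < a * v $ 1 + (1 - a)" using calculation a by linarith+
  ultimately show ?thesis
    using a assms unfolding atLeastAtMost_1_5 open_unit_square_def mem_Collect_eq
    by (elim insertE emptyE) (simp_all only: ifs_map_component, simp_all)
qed

lemma S_open_disjoint:
  assumes "u \<in> open_unit_square" "v \<in> open_unit_square" "i \<in> {1..5}" "j \<in> {1..5}" "S i u = S j v"
  shows "i = j"
proof -
  have m: "0 < a * v $ 1" "a * v $ 1 < a" "0 < a * u $ 1" "a * u $ 1 < a"
    "\<epsilon> * v $ 1 > 0" "\<epsilon> * u $ 1 > 0" "\<epsilon> * v $ 2 > 0" "\<epsilon> * u $ 2 > 0"
    using a eps_pos assms(1,2) by (auto simp: open_unit_square_def)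
  have "S i u $ 1 = S j v $ 1" "S i u $ 2 = S j v $ 2" using assms(5) by auto
  then show ?thesis
    using m a assms(1-4) unfolding atLeastAtMost_1_5
    by (elim insertE emptyE; simp add: ifs_map_component open_unit_square_def)
qed

text \<open>The same subdivision yields separated points.  Neighbouring rectangles may touch, so the points are
chosen in the interior: the last clause keeps a neighbourhood of each of them inside the image of the
open square, and the images belonging to different children are disjoint.  In a stopped rectangle the
points are taken from the image of \<open>S\<^sub>2 S\<^sub>4\<close>, which stays at distance \<open>1/6\<close> from the
boundary of the unit square, and are spread along the longer side.\<close>

lemma packing_image:
  assumes "axis_affine f x y" "x > 0" "y > 0" "\<delta> > 0"
    and "\<epsilon> * \<delta> \<le> min x y" "max x y \<le> 2 ^ n * \<delta>"
  shows "\<exists>P\<subseteq>f ` F. 2 / (3 * (p + q)) * \<delta> powr (-s) * \<phi> x y \<le> real (card P)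
    \<and> separated (\<epsilon> / 6 * \<delta>) P
    \<and> (\<forall>u\<in>P. \<forall>z. infnorm (u - z) < \<epsilon> / 6 * \<delta> \<longrightarrow> z \<in> f ` open_unit_square)"
  using assms
proof (induction n arbitrary: f x y)
  have r: "\<epsilon> / 6 * \<delta> > 0" using assms eps_pos by simp
  have stop: "\<exists>P\<subseteq>f ` F. 2 / (3 * (p + q)) * \<delta> powr (-s) * \<phi> x y \<le> real (card P)
    \<and> separated (\<epsilon> / 6 * \<delta>) P
    \<and> (\<forall>u\<in>P. \<forall>z. infnorm (u - z) < \<epsilon> / 6 * \<delta> \<longrightarrow> z \<in> f ` open_unit_square)"
    if f: "axis_affine f x y" "x > 0" "y > 0" "\<delta> > 0" "\<epsilon> * \<delta> \<le> min x y" "min x y \<le> \<delta>" for f x y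
  proof -
    define g where "g = f \<circ> S 2 \<circ> S 4"
    define M where "M = max x y"
    define j :: 2 where "j = (if y \<le> x then 1 else 2)"
    have g: "axis_affine g (x * a * a) (y / 3 / 3)"
      unfolding g_def using f(1) by (intro axis_affine_comp_ifs_map) auto
    have inj: "inj g" using axis_affine_bij[OF g] f a by (simp add: bij_def)
    define N where "N = nat \<lfloor>2 * M / (3 * \<delta>)\<rfloor>"
    have M: "M > 0" using f by (simp add: M_def)
    have N: "real N \<le> 2 * M / (3 * \<delta>)" "2 * M / (3 * \<delta>) \<le> real (Suc N)"
      using f M unfolding N_def by (simp, linarith)
    obtain P where P: "P \<subseteq> F" "finite P" "card P = Suc N"
      "\<And>u v. u \<in> P \<Longrightarrow> v \<in> P \<Longrightarrow> u \<noteq> v \<Longrightarrow> \<epsilon> / real N \<le> \<bar>u $ j - v $ j\<bar>"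
      using points_along_axis[of N j] by blast
    have sep: "\<epsilon> / 6 * \<delta> \<le> infnorm (g u - g v)" if uv: "u \<in> P" "v \<in> P" "u \<noteq> v" for u v
    proof -
      have "card {u, v} \<le> card P" using uv P by (intro card_mono) auto
      then have N0: "real N > 0" using uv P by simp
      have "1/3 * (1/3) \<le> a * a" using a by (intro mult_mono) auto
      then have xa: "x / 9 \<le> x * a * a" using f by (simp add: mult.assoc)
      have "M / 9 * (\<epsilon> / real N) \<le> M / 9 * \<bar>u $ j - v $ j\<bar>"
        using P(4)[OF uv] M by (intro mult_left_mono) auto
      also have "\<dots> \<le> max (x * a * a * \<bar>u $ 1 - v $ 1\<bar>) (y / 3 / 3 * \<bar>u $ 2 - v $ 2\<bar>)"
      proof (cases "y \<le> x")
        case True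
        then have "M / 9 * \<bar>u $ j - v $ j\<bar> \<le> x * a * a * \<bar>u $ 1 - v $ 1\<bar>"
          using mult_right_mono[OF xa, of "\<bar>u $ 1 - v $ 1\<bar>"]
          unfolding M_def j_def by (simp add: max_def)
        then show ?thesis by simp
      qed (simp add: M_def j_def)
      also have "\<dots> = infnorm (g u - g v)"
        using axis_affine_infnorm[OF g] f a by simp
      finally have "M / 9 * (\<epsilon> / real N) \<le> infnorm (g u - g v)" .
      moreover have "\<epsilon> / 6 * \<delta> \<le> M / 9 * (\<epsilon> / real N)"
        using N(1) N0 f(4) eps_pos by (simp add: field_simps)
      ultimately show ?thesis by linarith
    qed
    have near: "z \<in> f ` open_unit_square" if "u \<in> P" "infnorm (g u - z) < \<epsilon> / 6 * \<delta>" for u z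
    proof -
      have "surj f" using axis_affine_bij[OF f(1-3)] by (simp add: bij_def)
      then obtain z' where z: "z = f z'" by blast
      define u' where "u' = S 2 (S 4 u)"
      have "max (x * \<bar>u' $ 1 - z' $ 1\<bar>) (y * \<bar>u' $ 2 - z' $ 2\<bar>) < \<epsilon> * \<delta> * (1/6)"
        using that(2) axis_affine_infnorm[OF f(1), of u' z'] f(2,3)
        by (simp add: g_def z u'_def)
      moreover have "\<epsilon> * \<delta> * \<bar>u' $ 1 - z' $ 1\<bar> \<le> x * \<bar>u' $ 1 - z' $ 1\<bar>"
        "\<epsilon> * \<delta> * \<bar>u' $ 2 - z' $ 2\<bar> \<le> y * \<bar>u' $ 2 - z' $ 2\<bar>"
        using f(5) by (auto intro!: mult_right_mono)
      ultimately have "\<epsilon> * \<delta> * \<bar>u' $ 1 - z' $ 1\<bar> < \<epsilon> * \<delta> * (1/6)"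
        "\<epsilon> * \<delta> * \<bar>u' $ 2 - z' $ 2\<bar> < \<epsilon> * \<delta> * (1/6)" by linarith+
      then have close: "\<bar>u' $ 1 - z' $ 1\<bar> < 1/6" "\<bar>u' $ 2 - z' $ 2\<bar> < 1/6"
        using eps_pos f(4) by (simp_all only: mult_less_cancel_left_pos mult_pos_pos)
      have u: "0 \<le> u $ 1" "u $ 1 \<le> 1" "0 \<le> u $ 2" "u $ 2 \<le> 1"
        using that P F_coord_bounds by blast+
      \<comment> \<open>\<open>S\<^sub>2 S\<^sub>4\<close> maps the unit square onto \<open>[a (1 - a), a] \<times> [1/3, 4/9]\<close>.\<close>
      have "a * (1 - a) - 1/6 = (a - 1/3) * (2/3 - a) + (1/18)" by (simp add: field_simps)
      moreover have "(a - 1/3) * (2/3 - a) \<ge> 0" using a by (intro mult_nonneg_nonneg) auto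
      ultimately have "1/6 \<le> a * (1 - a)" by linarith
      moreover have "a * (1 - a) \<le> a * (a * u $ 1 + (1 - a))"
        using u a by (intro mult_left_mono) auto
      moreover have "a * (a * u $ 1 + (1 - a)) \<le> a * 1"
        using u a by (intro mult_left_mono) (auto simp: mult_left_le)
      ultimately have "1/6 \<le> u' $ 1" "u' $ 1 \<le> a" "1/3 \<le> u' $ 2" "u' $ 2 \<le> 4/9"
        using u by (auto simp: u'_def ifs_map_component)
      then have "z' \<in> open_unit_square" 
        using close[unfolded abs_less_iff] a by (simp add: open_unit_square_def)
      then show ?thesis using z by blast
    qed
    have "S 2 (S 4 u) \<in> F" if "u \<in> P" for u using that P by (intro S_in_F) auto
    then have "g ` P \<subseteq> f ` F" by (auto simp: g_def)
    moreover have "card (g ` P) = Suc N" using P inj by (simp add: card_image inj_on_subset)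
    moreover have "2 / (3 * (p + q)) * \<delta> powr (-s) * \<phi> x y \<le> real (Suc N)"
    proof -
      have "\<phi> x y \<le> (p + q) * M * min x y powr (s - 1)"
        unfolding M_def by (rule weight_bounds[OF f(2,3)])
      also have "\<dots> \<le> (p + q) * M * \<delta> powr (s - 1)"
        using f s pq M by (intro mult_left_mono powr_mono2) auto
      finally have "2 / (3 * (p + q)) * \<delta> powr (-s) * \<phi> x y
          \<le> 2 / (3 * (p + q)) * \<delta> powr (-s) * ((p + q) * M * \<delta> powr (s - 1))"
        using pq by (intro mult_left_mono) auto
      also have "\<dots> = (2 / (3 * (p + q)) * (p + q)) * M * (\<delta> powr (-s) * \<delta> powr (s - 1))"
        by (simp only: mult_ac)
      also have "2 / (3 * (p + q)) * (p + q) = 2 / 3" using pq by (simp add: divide_simps)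
      also have "\<delta> powr (-s) * \<delta> powr (s - 1) = \<delta> powr (-1)" by (simp add: powr_add[symmetric])
      also have "\<dots> = 1 / \<delta>" using f(4) by (simp add: powr_minus_divide)
      finally show ?thesis using N(2) by simp
    qed
    moreover have "separated (\<epsilon> / 6 * \<delta>) (g ` P)"
      unfolding separated_def pairwise_def
    proof (intro conjI ballI impI)
      fix u v assume uv: "u \<in> g ` P" "v \<in> g ` P" "u \<noteq> v"
      then obtain u' v' where "u' \<in> P" "v' \<in> P" "u = g u'" "v = g v'" by blast
      then show "\<epsilon> / 6 * \<delta> \<le> infnorm (u - v)" using sep[of u' v'] uv(3) by blast
    qed (use P(2) in simp)
    ultimately show ?thesis
      using near by (intro exI[of _ "g ` P"]) auto
  qed
  {
    case (0 f x y)
    then show ?case by (intro stop) auto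
  next
    case (Suc n f x y)
    show ?case
    proof (cases "min x y \<le> \<delta>")
      case True
      then show ?thesis using Suc.prems by (intro stop) auto
    next
      case False
      let ?c = "2 / (3 * (p + q)) * \<delta> powr (-s)"
      let ?w = "\<lambda>i::nat. if i = 5 then \<phi> (y * \<epsilon>) (x * \<epsilon>) else \<phi> (x * a) (y / 3)"
      have inj: "inj f" using axis_affine_bij[OF Suc.prems(1-3)] by (simp add: bij_def)
      have "\<exists>P\<subseteq>(f \<circ> S i) ` F. ?c * ?w i \<le> real (card P) \<and> separated (\<epsilon> / 6 * \<delta>) P
          \<and> (\<forall>u\<in>P. \<forall>z. infnorm (u - z) < \<epsilon> / 6 * \<delta> \<longrightarrow> z \<in> (f \<circ> S i) ` open_unit_square)"
        if i: "i \<in> {1..5}" for i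
      proof -
        have "\<delta> < min x y" using False by (simp only: not_le)
        from child_affine[OF Suc.prems(1) i Suc.prems(2,3,4) this Suc.prems(6)]
        obtain x' y' where xy: "axis_affine (f \<circ> S i) x' y'" "x' > 0" "y' > 0"
          "\<epsilon> * \<delta> \<le> min x' y'" "max x' y' \<le> 2 ^ n * \<delta>" "\<phi> x' y' = ?w i" by blast
        show ?thesis
          using Suc.IH[OF xy(1-3) Suc.prems(4) xy(4,5)] unfolding xy(6) .
      qed
      then obtain P where P: "\<And>i. i \<in> {1..5} \<Longrightarrow> P i \<subseteq> (f \<circ> S i) ` F"
        "\<And>i. i \<in> {1..5} \<Longrightarrow> ?c * ?w i \<le> real (card (P i))"
        "\<And>i. i \<in> {1..5} \<Longrightarrow> separated (\<epsilon> / 6 * \<delta>) (P i)"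
        "\<And>i u z. i \<in> {1..5} \<Longrightarrow> u \<in> P i \<Longrightarrow> infnorm (u - z) < \<epsilon> / 6 * \<delta>
          \<Longrightarrow> z \<in> (f \<circ> S i) ` open_unit_square" by metis
      have apart: "\<epsilon> / 6 * \<delta> \<le> infnorm (u - v)"
        if "i \<in> {1..5}" "j \<in> {1..5}" "i \<noteq> j" "u \<in> P i" "v \<in> P j" for i j u v
      proof (rule ccontr)
        assume "\<not> \<epsilon> / 6 * \<delta> \<le> infnorm (u - v)"
        then have "v \<in> (f \<circ> S i) ` open_unit_square" using P(4)[OF that(1,4)] by simp
        moreover have "v \<in> (f \<circ> S j) ` open_unit_square"
          using P(4)[OF that(2,5), of v] r by (simp add: infnorm_0)
        ultimately show False
          using S_open_disjoint[OF _ _ that(1,2)] that(3) inj by (auto dest: injD)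
      qed
      let ?P = "\<Union>i\<in>{1..5}. P i"
      have U1: "separated (\<epsilon> / 6 * \<delta>) ?P"
        by (rule separated_UN(1); fact finite_atLeastAtMost P(3) r apart)
      have U2: "card ?P = (\<Sum>i\<in>{1..5}. card (P i))"
        by (rule separated_UN(2); fact finite_atLeastAtMost P(3) r apart)
      have "?c * \<phi> x y = (\<Sum>i\<in>{1..5}. ?c * ?w i)"
        unfolding sum_distrib_left[symmetric] sum_children[OF Suc.prems(2,3)] ..
      also have "\<dots> \<le> (\<Sum>i\<in>{1..5}. real (card (P i)))" by (intro sum_mono P(2))
      finally have "?c * \<phi> x y \<le> real (card ?P)" unfolding U2 of_nat_sum .
      moreover have "?P \<subseteq> f ` F" unfolding image_F_split[of f] using P(1) by blast
      moreover have "z \<in> f ` open_unit_square" if "u \<in> ?P" "infnorm (u - z) < \<epsilon> / 6 * \<delta>" for u z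
      proof -
        obtain i where i: "i \<in> {1..5}" "u \<in> P i" using \<open>u \<in> ?P\<close> by (rule UN_E)
        then have "z \<in> (f \<circ> S i) ` open_unit_square" using P(4) that by blast
        then show ?thesis using S_open_unit_square i by auto
      qed
      ultimately show ?thesis using U1 by (intro exI[of _ ?P] conjI ballI allI impI)
    qed
  }
qed

lemma box_dim_F: "box_dim F = s"
proof (rule box_dim_eqI)
  show "2 / (3 * (p + q)) * \<phi> 1 1 > 0" "\<epsilon> / 6 > 0"
    using pq eps_pos by (auto simp: \<phi>_def)
  fix \<delta> :: real assume d: "0 < \<delta>" "\<delta> < 1"
  obtain n where "1 / \<delta> < 2 ^ n" using real_arch_pow[of 2 "1 / \<delta>"] by auto
  then have n: "max 1 1 \<le> 2 ^ n * \<delta>" using d by (simp add: field_simps)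
  have e: "\<epsilon> * \<delta> \<le> min 1 1" using d eps by (simp add: mult_le_one)
  have swap: "c * \<delta> powr (-s) * \<phi> 1 1 = c * \<phi> 1 1 * \<delta> powr (-s)" for c by simp
  show "\<exists>n. real n \<le> (1 + 1 / \<epsilon>) / (min p q * \<epsilon> powr (s - 1)) * \<phi> 1 1 * \<delta> powr (-s) \<and> covered_by n \<delta> F"
    using cover_image[OF axis_affine_id zero_less_one zero_less_one d(1) e n]
    unfolding swap image_id id_apply .
  show "\<exists>P\<subseteq>F. 2 / (3 * (p + q)) * \<phi> 1 1 * \<delta> powr (-s) \<le> real (card P) \<and> separated (\<epsilon> / 6 * \<delta>) P"
    using packing_image[OF axis_affine_id zero_less_one zero_less_one d(1) e n]
    unfolding swap image_id id_apply by blast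
qed

end

context carpet_pos
begin

text \<open>The matrix \<open>((M\<^sub>1, \<epsilon>\<^sup>s), (\<epsilon>\<^sup>s, M\<^sub>2))\<close> of \<open>carpet_weight\<close> has eigenvalue 1 iff \<open>g\<close>, its characteristic
polynomial at 1, vanishes.  At \<open>s = s\<^sub>1\<close>, where \<open>M\<^sub>1 = 1\<close>, only the negative off-diagonal term of \<open>g\<close>
remains, whereas \<open>g > 0\<close> at \<open>s = 2\<close>.  At a root in between \<open>M\<^sub>1 < 1\<close>, which makes the eigenvector
\<open>(\<epsilon>\<^sup>s, 1 - M\<^sub>1)\<close> positive.\<close>

lemma box_dim_F_gt: "box_dim F > 1 + ln (4 * a) / ln 3"
proof -
  define s1 where "s1 = 1 + ln (4 * a) / ln 3"
  define M1 where "M1 = (\<lambda>s. 4 * a * (1/3) powr (s - 1))"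
  define M2 where "M2 = (\<lambda>s. 4 * (1/3) * a powr (s - 1))"
  define g where "g = (\<lambda>s. (1 - M1 s) * (1 - M2 s) - (\<epsilon> powr s)\<^sup>2)"
  have "ln (4 * a) > 0" "ln (4 * a) < ln 3" using a by auto
  then have s1: "1 < s1" "s1 < 2" by (auto simp: s1_def)
  have "(1/3) powr (s1 - 1) = exp (- ln (4 * a))"
    by (simp add: s1_def powr_def ln_div)
  also have "\<dots> = 1 / (4 * a)" using a by (simp add: exp_minus inverse_eq_divide)
  finally have M1: "M1 s1 = 1" using a by (simp add: M1_def)
  have g1: "g s1 < 0" using eps_pos by (simp add: g_def M1)
  have g2: "g 2 > 0"
  proof -
    have "(\<epsilon>\<^sup>2)\<^sup>2 \<le> ((1/10)\<^sup>2)\<^sup>2" using eps by (intro power_mono) auto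
    moreover have "(1 - 4 * a / 3)\<^sup>2 \<ge> (1/3)\<^sup>2" using a by (intro power_mono) auto
    moreover have "g 2 = (1 - 4 * a / 3)\<^sup>2 - (\<epsilon>\<^sup>2)\<^sup>2"
      using a eps_pos by (simp add: g_def M1_def M2_def power2_eq_square)
    ultimately show ?thesis by (simp add: power2_eq_square)
  qed
  have "continuous_on {s1..2} g"
    unfolding g_def M1_def M2_def using a eps_pos by (intro continuous_intros) auto
  then obtain s where s: "s1 \<le> s" "s \<le> 2" "g s = 0"
    using IVT'[of g s1 0 2] g1 g2 s1 by auto
  have "s \<noteq> s1" "s \<noteq> 2" using s(3) g1 g2 by auto
  then have s': "s1 < s" "s < 2" using s by auto
  have "(1/3 :: real) powr (s - 1) < (1/3) powr (s1 - 1)" using s' by (intro powr_less_mono') auto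
  then have "4 * a * (1/3) powr (s - 1) < 4 * a * (1/3) powr (s1 - 1)"
    using a by (intro mult_strict_left_mono) auto
  then have M1s: "M1 s < 1" using M1 by (simp only: M1_def)
  have zero: "(1 - M1 s) * (1 - M2 s) = (\<epsilon> powr s) * (\<epsilon> powr s)"
    using s(3) by (simp add: g_def power2_eq_square)
  have e1: "M1 s * (\<epsilon> powr s) + \<epsilon> powr s * (1 - M1 s) = \<epsilon> powr s" by (simp add: algebra_simps)
  have e2: "M2 s * (1 - M1 s) + \<epsilon> powr s * \<epsilon> powr s = 1 - M1 s"
    unfolding zero[symmetric] by (simp add: algebra_simps)
  interpret carpet_weight a \<epsilon> s "\<epsilon> powr s" "1 - M1 s"
    using s1 s' M1s eps_pos e1 e2 unfolding M1_def M2_def by unfold_locales auto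
  show ?thesis using box_dim_F s' by (simp add: s1_def)
qed

end

section \<open>Pressure for positive parameter\<close>

text \<open>Fekete's lemma: writing \<open>n = q m + r\<close> gives \<open>b n / n \<le> b m / m + O(1/n)\<close> for each fixed \<open>m\<close>, so the limit
is the infimum of the quotients, which the lower bound makes finite.\<close>

lemma subadditive_convergent:
  fixes b :: "nat \<Rightarrow> real"
  assumes sub: "\<And>m n. b (m + n) \<le> b m + b n" and lower: "\<And>n. - C * real n \<le> b n"
  shows "convergent (\<lambda>n. b n / real n)"
proof -
  define L where "L = Inf ((\<lambda>n. b n / real n) ` {1..})"
  have "- C \<le> b n / real n" if "n \<ge> 1" for n
    using lower[of n] that by (simp add: field_simps)
  then have bdd: "bdd_below ((\<lambda>n. b n / real n) ` {1..})" by (auto intro!: bdd_belowI)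
  have L: "L \<le> b n / real n" if "n \<ge> 1" for n
    unfolding L_def using bdd that by (intro cInf_lower) auto
  have mult: "b (q * m + r) \<le> real q * b m + b r" for q m r
  proof (induction q)
    case (Suc q)
    have "b (Suc q * m + r) \<le> b m + b (q * m + r)" using sub[of m "q * m + r"] by (simp add: add.assoc)
    then show ?case using Suc by (simp add: algebra_simps)
  qed simp
  have "(\<lambda>n. b n / real n) \<longlonglongrightarrow> L"
  proof (rule order_tendstoI)
    fix c assume "c < L"
    show "\<forall>\<^sub>F n in sequentially. c < b n / real n"
      using eventually_ge_at_top[of 1]
    proof eventually_elim
      case (elim n)
      then show ?case using L[of n] \<open>c < L\<close> by linarith
    qed
  next
    fix c assume c: "L < c"
    then obtain m where m: "m \<ge> 1" "b m / real m < c"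
      unfolding L_def using bdd by (subst (asm) cInf_less_iff) auto
    define B where "B = \<bar>b m\<bar> + (\<Sum>r<m. \<bar>b r\<bar>)"
    have le: "b n / real n \<le> b m / real m + B / real n" if n: "n \<ge> 1" for n
    proof -
      have "\<bar>b (n mod m)\<bar> \<le> (\<Sum>r<m. \<bar>b r\<bar>)" using m by (intro member_le_sum) auto
      moreover have "b n \<le> real (n div m) * b m + b (n mod m)"
        using mult[of "n div m" m "n mod m"] by simp
      moreover have "real (n div m) * b m \<le> real n * (b m / real m) + \<bar>b m\<bar>"
      proof -
        have "real n = real (n div m) * real m + real (n mod m)"
          by (metis div_mult_mod_eq of_nat_add of_nat_mult)
        then have "real n * (b m / real m) = real (n div m) * b m + real (n mod m) / real m * b m"
          using m by (simp add: field_simps)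
        moreover have "\<bar>real (n mod m) / real m * b m\<bar> \<le> 1 * \<bar>b m\<bar>"
          unfolding abs_mult using m by (intro mult_right_mono) auto
        ultimately show ?thesis by linarith
      qed
      ultimately have "b n \<le> real n * (b m / real m) + B" unfolding B_def by linarith
      then have "b n / real n \<le> (real n * (b m / real m) + B) / real n"
        by (rule divide_right_mono) simp
      also have "\<dots> = b m / real m + B / real n" using n by (simp add: add_divide_distrib)
      finally show ?thesis .
    qed
    have "(\<lambda>n. b m / real m + B / real n) \<longlonglongrightarrow> b m / real m + 0"
      by (intro tendsto_add tendsto_const lim_const_over_n)
    then have "\<forall>\<^sub>F n in sequentially. b m / real m + B / real n < c"
      using m(2) by (intro order_tendstoD(2)) auto
    then show "\<forall>\<^sub>F n in sequentially. b n / real n < c"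
      using eventually_ge_at_top[of 1] by eventually_elim (rule le_less_trans[OF le])
  qed
  then show ?thesis by (rule convergentI)
qed

lemma word_map_append: "word_map a \<epsilon> (u @ v) = word_map a \<epsilon> u \<circ> word_map a \<epsilon> v"
  by (induction u) (simp_all add: word_map_def comp_assoc)

lemma words_append: "bij_betw (\<lambda>(u, v). u @ v) (words m \<times> words n) (words (m + n))"
proof (rule bij_betwI[where g = "\<lambda>w. (take m w, drop m w)"])
  show "(\<lambda>w. (take m w, drop m w)) \<in> words (m + n) \<rightarrow> words m \<times> words n"
    by (auto simp: words_def dest: in_set_takeD in_set_dropD)
qed (auto simp: words_def subset_iff)

lemma card_words: "card (words k) = 5 ^ k" "finite (words k)"
  using card_lists_length_eq[of "{1..5::nat}" k] finite_lists_length_eq[of "{1..5::nat}" k]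
  by (simp_all add: words_def conj_commute)

lemma card_words4: "card {w. length w = k \<and> set w \<subseteq> {1..4::nat}} = 4 ^ k"
  using card_lists_length_eq[of "{1..4::nat}" k] by (simp add: conj_commute)

context carpet
begin

lemma word_map_diagonal:
  "set w \<subseteq> {1..4} \<Longrightarrow> \<exists>t u. \<forall>v. word_map a \<epsilon> w v $ 1 = a ^ length w * v $ 1 + t
     \<and> word_map a \<epsilon> w v $ 2 = (1/3) ^ length w * v $ 2 + u"
proof (induction w)
  case Nil
  then show ?case by (auto simp: word_map_def)
next
  case (Cons i w)
  then obtain t u where *: "\<And>v. word_map a \<epsilon> w v $ 1 = a ^ length w * v $ 1 + t"
     "\<And>v. word_map a \<epsilon> w v $ 2 = (1/3) ^ length w * v $ 2 + u" by auto
  show ?case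
    using Cons.prems
    by (intro exI[of _ "a * t + (if i = 4 then 1 - a else 0)"]
        exI[of _ "u / 3 + (if i = 4 then 0 else (real i - 1) / 3)"])
      (auto simp: word_map_Cons ifs_map_component * algebra_simps add_divide_distrib)
qed

lemma power_a_le: "(1/3) ^ k \<le> a ^ k" "a ^ k > 0"
  using a by (auto intro: power_mono)

lemma alpha_word4:
  assumes "set w \<subseteq> {1..4}"
  shows "alpha1 (linear_part (word_map a \<epsilon> w)) = a ^ length w"
    "alpha2 (linear_part (word_map a \<epsilon> w)) = (1/3) ^ length w"
proof -
  have "axis_affine (word_map a \<epsilon> w) (a ^ length w) ((1/3) ^ length w)"
    using word_map_diagonal[OF assms] unfolding axis_affine_def by blast
  from alpha_axis_affine[OF this] power_a_le[of "length w"]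
  show "alpha1 (linear_part (word_map a \<epsilon> w)) = a ^ length w"
    "alpha2 (linear_part (word_map a \<epsilon> w)) = (1/3) ^ length w" by (simp_all add: max_def min_def)
qed

end

context carpet_pos
begin

definition word_weight :: "real \<Rightarrow> nat list \<Rightarrow> real" where
  "word_weight s w = alpha1 (linear_part (word_map a \<epsilon> w)) powr 1
     * alpha2 (linear_part (word_map a \<epsilon> w)) powr (s - 1)"

lemma pressure_sum_eq: "pressure_sum a \<epsilon> s k = (\<Sum>w\<in>words k. word_weight s w)"
  by (simp add: pressure_sum_def word_weight_def p1_eq_1)

lemma word_map_affine:
  "set w \<subseteq> {1..5} \<Longrightarrow> \<exists>x y. axis_affine (word_map a \<epsilon> w) x y \<and> 0 < x \<and> x \<le> 1 \<and> 0 < y \<and> y \<le> 1"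
proof (induction w)
  case Nil
  have "axis_affine (word_map a \<epsilon> []) 1 1" using axis_affine_id by (simp add: word_map_def id_def)
  then show ?case by (intro exI[of _ 1]) simp
next
  case (Cons i w)
  then obtain x y where w: "axis_affine (word_map a \<epsilon> w) x y" "0 < x" "x \<le> 1" "0 < y" "y \<le> 1" by auto
  obtain x' y' where i: "axis_affine (S i) x' y'" "0 < x'" "x' \<le> 1" "0 < y'" "y' \<le> 1"
  proof (cases "i = 5")
    case True
    then show ?thesis using that[of \<epsilon> \<epsilon>] axis_affine_ifs_map(2) eps eps_pos by auto
  next
    case False
    then show ?thesis using that[of a "1/3"] axis_affine_ifs_map(1)[of i] Cons.prems a by auto
  qed
  have "0 < x' * x" "x' * x \<le> 1" "0 < y' * y" "y' * y \<le> 1" "0 < y' * x" "y' * x \<le> 1" "0 < x' * y" "x' * y \<le> 1"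
    using w i by (auto intro!: mult_le_one)
  then show ?case
    using axis_affine_comp[OF i(1) w(1)] unfolding word_map_Cons by blast
qed

lemma word_weight_affine:
  assumes "axis_affine (word_map a \<epsilon> w) x y" "x > 0" "y > 0"
  shows "word_weight s w = max x y powr (2 - s) * (x * y) powr (s - 1)"
  using alpha_axis_affine[OF assms(1)] assms max_times_min_powr[OF assms(2,3), of s]
  by (simp add: word_weight_def)

text \<open>In the form of \<open>word_weight_affine\<close> the determinant factor is multiplicative, while the larger singular
value is submultiplicative and enters with the exponent \<open>2 - s\<close>, whose sign decides the direction.\<close>

lemma word_weight_append:
  assumes "set u \<subseteq> {1..5}" "set v \<subseteq> {1..5}"
  shows "s \<le> 2 \<Longrightarrow> word_weight s (u @ v) \<le> word_weight s u * word_weight s v"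
    and "2 \<le> s \<Longrightarrow> word_weight s u * word_weight s v \<le> word_weight s (u @ v)"
proof -
  obtain x y where u: "axis_affine (word_map a \<epsilon> u) x y" "0 < x" "0 < y"
    using word_map_affine[OF assms(1)] by blast
  obtain x' y' where v: "axis_affine (word_map a \<epsilon> v) x' y'" "0 < x'" "0 < y'"
    using word_map_affine[OF assms(2)] by blast
  obtain X Y where X: "axis_affine (word_map a \<epsilon> (u @ v)) X Y" "0 < X" "0 < Y"
    "X * Y = (x * y) * (x' * y')" "max X Y \<le> max x y * max x' y'"
  proof -
    have "x * x' \<le> max x y * max x' y'" "y * y' \<le> max x y * max x' y'"
      "x * y' \<le> max x y * max x' y'" "y * x' \<le> max x y * max x' y'"
      using u v by (auto intro!: mult_mono simp: le_max_iff_disj)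
    then show ?thesis
      using axis_affine_comp[OF u(1) v(1)] u v that[of "x * x'" "y * y'"] that[of "y * x'" "x * y'"]
      unfolding word_map_append by (auto simp: mult_ac)
  qed
  have prod: "word_weight s u * word_weight s v = (max x y * max x' y') powr (2 - s) * (X * Y) powr (s - 1)"
    unfolding word_weight_affine[OF u] word_weight_affine[OF v] X(4) by (simp only: powr_mult mult_ac)
  note app = word_weight_affine[OF X(1-3), of s]
  have pos: "0 < max X Y" using X by auto
  show "s \<le> 2 \<Longrightarrow> word_weight s (u @ v) \<le> word_weight s u * word_weight s v"
    unfolding prod app using X(5) pos by (intro mult_right_mono powr_mono2) auto
  show "2 \<le> s \<Longrightarrow> word_weight s u * word_weight s v \<le> word_weight s (u @ v)"
    unfolding prod app using X(5) pos by (intro mult_right_mono powr_mono2') auto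
qed

lemma word_weight_nonneg: "word_weight s w \<ge> 0"
  by (simp add: word_weight_def)

lemma pressure_sum_append:
  "s \<le> 2 \<Longrightarrow> pressure_sum a \<epsilon> s (m + n) \<le> pressure_sum a \<epsilon> s m * pressure_sum a \<epsilon> s n"
  "2 \<le> s \<Longrightarrow> pressure_sum a \<epsilon> s m * pressure_sum a \<epsilon> s n \<le> pressure_sum a \<epsilon> s (m + n)"
proof -
  have A: "pressure_sum a \<epsilon> s (m + n) = (\<Sum>(u, v)\<in>words m \<times> words n. word_weight s (u @ v))"
    unfolding pressure_sum_eq sum.reindex_bij_betw[OF words_append, symmetric]
    by (simp add: case_prod_unfold)
  have B: "pressure_sum a \<epsilon> s m * pressure_sum a \<epsilon> s n
      = (\<Sum>(u, v)\<in>words m \<times> words n. word_weight s u * word_weight s v)"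
    unfolding pressure_sum_eq sum_product by (simp add: sum.cartesian_product)
  show "s \<le> 2 \<Longrightarrow> pressure_sum a \<epsilon> s (m + n) \<le> pressure_sum a \<epsilon> s m * pressure_sum a \<epsilon> s n"
    unfolding A B by (rule sum_mono) (auto simp: words_def intro!: word_weight_append)
  show "2 \<le> s \<Longrightarrow> pressure_sum a \<epsilon> s m * pressure_sum a \<epsilon> s n \<le> pressure_sum a \<epsilon> s (m + n)"
    unfolding A B by (rule sum_mono) (auto simp: words_def intro!: word_weight_append)
qed

lemma pressure_sum_ge: "(4 * a * (1/3) powr (s - 1)) ^ k \<le> pressure_sum a \<epsilon> s k"
proof -
  let ?W = "{w. length w = k \<and> set w \<subseteq> {1..4::nat}}"
  have "((1/3::real) ^ k) powr (s - 1) = ((1/3) powr (s - 1)) ^ k"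
    by (simp add: powr_realpow[symmetric] powr_powr mult.commute)
  then have "word_weight s w = a ^ k * ((1/3) powr (s - 1)) ^ k" if "w \<in> ?W" for w
    using that alpha_word4[of w] power_a_le[of k] by (simp add: word_weight_def)
  then have "(\<Sum>w\<in>?W. word_weight s w) = 4 ^ k * (a ^ k * ((1/3) powr (s - 1)) ^ k)"
    using card_words4[of k] by simp
  also have "\<dots> = (4 * a * (1/3) powr (s - 1)) ^ k" by (simp add: power_mult_distrib)
  finally have "(4 * a * (1/3) powr (s - 1)) ^ k = (\<Sum>w\<in>?W. word_weight s w)" ..
  also have "\<dots> \<le> pressure_sum a \<epsilon> s k"
    unfolding pressure_sum_eq
    by (rule sum_mono2) (use card_words word_weight_nonneg in \<open>auto simp: words_def\<close>)
  finally show ?thesis .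
qed

lemma pressure_sum_le: "2 \<le> s \<Longrightarrow> pressure_sum a \<epsilon> s k \<le> 5 ^ k"
proof -
  assume s: "2 \<le> s"
  have "word_weight s w \<le> 1" if w: "w \<in> words k" for w
  proof -
    obtain x y where xy: "axis_affine (word_map a \<epsilon> w) x y" "0 < x" "x \<le> 1" "0 < y" "y \<le> 1"
      using word_map_affine[of w] w unfolding words_def mem_Collect_eq by blast
    then have "min x y powr (s - 1) \<le> 1" using s by (intro powr_le1) auto
    then show ?thesis
      using alpha_axis_affine[OF xy(1)] xy by (auto simp: word_weight_def intro!: mult_le_one)
  qed
  then have "pressure_sum a \<epsilon> s k \<le> (\<Sum>w\<in>words k. 1)"
    unfolding pressure_sum_eq by (rule sum_mono)
  then show ?thesis using card_words[of k] by simp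
qed

text \<open>Fekete's lemma is applied to the logarithm of the sums for \<open>s \<le> 2\<close> and to its negative for \<open>s \<ge> 2\<close>; the
linear bound that it needs is \<open>pressure_sum_ge\<close> in the first case and \<open>pressure_sum_le\<close> in the second.\<close>

lemma pressure_ge: "4 * a * (1/3) powr (s - 1) \<le> pressure a \<epsilon> s"
proof -
  define c where "c = 4 * a * (1/3) powr (s - 1)"
  define A where "A = pressure_sum a \<epsilon> s"
  have c: "c > 0" using a by (simp add: c_def)
  have Ac: "c ^ k \<le> A k" for k unfolding A_def c_def by (rule pressure_sum_ge)
  have A: "A k > 0" for k using Ac[of k] c by (meson less_le_trans zero_less_power)
  have lower: "real k * ln c \<le> ln (A k)" for k
    using Ac[of k] A c by (simp add: ln_realpow[symmetric])
  have "convergent (\<lambda>k. ln (A k) / real k)"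
  proof (cases "s \<le> 2")
    case True
    show ?thesis
    proof (rule subadditive_convergent)
      fix m n
      have "A (m + n) \<le> A m * A n" unfolding A_def using True by (rule pressure_sum_append)
      then have "ln (A (m + n)) \<le> ln (A m * A n)" using A by (intro ln_mono) auto
      then show "ln (A (m + n)) \<le> ln (A m) + ln (A n)" using A[of m] A[of n] by (simp add: ln_mult)
      show "- (- ln c) * real n \<le> ln (A n)" using lower[of n] by (simp add: mult.commute)
    qed
  next
    case False
    then have s: "2 \<le> s" by simp
    have "convergent (\<lambda>k. - ln (A k) / real k)"
    proof (rule subadditive_convergent)
      fix m n
      have "A m * A n \<le> A (m + n)" unfolding A_def using s by (rule pressure_sum_append)
      then have "ln (A m * A n) \<le> ln (A (m + n))" using A by (intro ln_mono) auto
      then show "- ln (A (m + n)) \<le> - ln (A m) + - ln (A n)" using A[of m] A[of n] by (simp add: ln_mult)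
      have "ln (A n) \<le> ln (5 ^ n)" unfolding A_def
        using A[of n] pressure_sum_le[OF s, of n] by (intro ln_mono) (auto simp: A_def)
      then show "- ln 5 * real n \<le> - ln (A n)" by (simp add: ln_realpow mult.commute)
    qed
    then show ?thesis using convergent_minus_iff[of "\<lambda>k. ln (A k) / real k"] by simp
  qed
  then obtain l where l: "(\<lambda>k. ln (A k) / real k) \<longlonglongrightarrow> l" by (auto simp: convergent_def)
  have "A k powr (1 / real k) = exp (ln (A k) / real k)" for k
    using A[of k] by (simp add: powr_def)
  then have "(\<lambda>k. A k powr (1 / real k)) \<longlonglongrightarrow> exp l" using tendsto_exp[OF l] by simp
  then have "pressure a \<epsilon> s = exp l" unfolding pressure_def A_def by (rule limI)
  moreover have "ln c \<le> l"
  proof (rule LIMSEQ_le_const[OF l], intro exI[of _ 1] allI impI)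
    fix k :: nat assume "k \<ge> 1"
    then show "ln c \<le> ln (A k) / real k" using lower[of k] by (simp add: field_simps)
  qed
  then have "c \<le> exp l" using c by (metis exp_le_cancel_iff exp_ln)
  ultimately show ?thesis by (simp add: c_def)
qed

end

section \<open>Dimensions and pressure at parameter zero\<close>

text \<open>Used to compare an arbitrary scale with the geometric scales of the construction.\<close>

lemma ex_power_bracket:
  fixes b \<delta> :: real
  assumes "0 < b" "b < 1" "0 < \<delta>" "\<delta> \<le> 1"
  obtains n where "\<delta> \<le> b ^ n" "b ^ Suc n < \<delta>"
proof -
  define m where "m = (LEAST m. b ^ m < \<delta>)"
  obtain k where "b ^ k < \<delta>" using real_arch_pow_inv[OF assms(3,2)] by blast
  then have m: "b ^ m < \<delta>" unfolding m_def by (rule LeastI)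
  then have "m \<noteq> 0" using assms by (intro notI) simp
  then obtain n where n: "m = Suc n" using not0_implies_Suc by blast
  have "\<not> b ^ n < \<delta>" using not_less_Least[of n "\<lambda>m. b ^ m < \<delta>"] n by (simp add: m_def[symmetric])
  then show ?thesis using that[of n] m n by simp
qed

lemma powr_power:
  fixes b d :: real
  assumes "b > 0"
  shows "(b ^ n) powr d = (b powr d) ^ n"
  using assms by (simp add: powr_realpow[symmetric] powr_powr mult.commute)

lemma covered_by_affine:
  assumes "covered_by n \<rho> E" "c > 0"
    and "\<And>q. q \<in> E' \<Longrightarrow> \<exists>p\<in>E. q $ 1 = c * p $ 1 + t \<and> u \<le> q $ 2 \<and> q $ 2 \<le> u + c * \<rho>"
  shows "covered_by n (c * \<rho>) E'"
proof -
  obtain C where C: "finite C" "card C \<le> n" "\<forall>p\<in>E. \<exists>z\<in>C. in_square \<rho> z p"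
    using assms(1) unfolding covered_by_def by (elim exE conjE)
  let ?g = "\<lambda>z :: real^2. vector [c * z $ 1 + t, u] :: real^2"
  show ?thesis unfolding covered_by_def
  proof (intro exI[of _ "?g ` C"] conjI ballI)
    show "finite (?g ` C)" "card (?g ` C) \<le> n" using C card_image_le order_trans by blast+
    fix q assume "q \<in> E'"
    then obtain p where p: "p \<in> E" "q $ 1 = c * p $ 1 + t" "u \<le> q $ 2" "q $ 2 \<le> u + c * \<rho>"
      using assms(3) by blast
    then obtain z where z: "z \<in> C" "in_square \<rho> z p" using C(3) by blast
    have "c * z $ 1 \<le> c * p $ 1" "c * p $ 1 \<le> c * (z $ 1 + \<rho>)"
      using z(2) assms(2) by (auto simp: in_square_def)
    then have "in_square (c * \<rho>) (?g z) q"
      using p by (simp add: in_square_def distrib_left)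
    then show "\<exists>y\<in>?g ` C. in_square (c * \<rho>) y q" using z(1) by blast
  qed
qed

locale carpet_zero = carpet a 0 for a
begin

definition d :: real where "d = ln 2 / (- ln a)"
definition e :: real where "e = ln 2 / ln 3"

lemma a_pos: "a > 0" "a < 1" using a by auto

lemma a_powr_d: "a powr d = 1/2" "a powr (-d) = 2"
proof -
  have "ln a \<noteq> 0" using a_pos by simp
  then have "a powr d = exp (- ln 2)" using a_pos by (simp add: powr_def d_def)
  then show "a powr d = 1/2" by (simp add: exp_minus)
  then show "a powr (-d) = 2" by (simp only: powr_minus) simp
qed

lemma third_powr_e: "(1/3) powr (-e) = 2"
  by (simp add: powr_def e_def ln_div)

lemma d_bounds: "0 < d" "d < 1"
proof -
  have "ln a < ln (1/2)" using a a_pos by (subst ln_less_cancel_iff) auto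
  then have "ln 2 < - ln a" by (simp add: ln_div)
  moreover from this have "0 < - ln a" by (rule less_trans[rotated]) simp
  ultimately show "0 < d" "d < 1" unfolding d_def by (auto simp only: divide_less_eq_1_pos intro!: divide_pos_pos ln_gt_zero)
qed

lemma e_pos: "e > 0"
  by (simp add: e_def)

abbreviation K where "K \<equiv> axis_projection 1 ` F"

text \<open>At \<open>\<epsilon> = 0\<close> the map \<open>S\<^sub>5\<close> is constant.\<close>

lemma mem_F_cases:
  assumes "p \<in> F"
  obtains i q where "i \<in> {1..4}" "q \<in> F" "p = S i q" | "p = vector [9/10, 9/10]"
proof -
  obtain i q where iq: "i \<in> {1..5}" "q \<in> F" "p = S i q" using F_invariant assms by blast
  show ?thesis
  proof (cases "i = 5")
    case True
    then have "p = vector [9/10, 9/10]" using iq by (simp add: vec2_eq_iff ifs_map_component)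
    then show ?thesis by (rule that(2))
  next
    case False
    then show ?thesis using iq that(1)[of i q] by auto
  qed
qed

lemma projection_cover_step:
  assumes "covered_by n (\<rho> / a) K" "\<rho> > 0"
  shows "covered_by (n + n + 1) \<rho> K"
proof -
  have 1: "covered_by n \<rho> {q. q $ 2 = 0 \<and> (\<exists>p\<in>K. q $ 1 = a * p $ 1 + t)}" for t
    using covered_by_affine[OF assms(1), of a "{q. q $ 2 = 0 \<and> (\<exists>p\<in>K. q $ 1 = a * p $ 1 + t)}" t 0]
      a_pos assms(2) by auto
  have "K \<subseteq> {q. q $ 2 = 0 \<and> (\<exists>p\<in>K. q $ 1 = a * p $ 1 + 0)} \<union> {q. q $ 2 = 0 \<and> (\<exists>p\<in>K. q $ 1 = a * p $ 1 + (1 - a))}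
      \<union> {axis_projection 1 (vector [9/10, 9/10])}"
  proof
    fix q assume "q \<in> K"
    then obtain p where p: "p \<in> F" "q = axis_projection 1 p" by blast
    from p(1) show "q \<in> {q. q $ 2 = 0 \<and> (\<exists>p\<in>K. q $ 1 = a * p $ 1 + 0)} \<union> {q. q $ 2 = 0 \<and> (\<exists>p\<in>K. q $ 1 = a * p $ 1 + (1 - a))}
      \<union> {axis_projection 1 (vector [9/10, 9/10])}"
    proof (cases rule: mem_F_cases)
      case (1 i r)
      then show ?thesis using p by (auto simp: axis_projection_def axis_def ifs_map_component)
    qed (use p in simp)
  qed
  moreover have "covered_by (n + n + 1) \<rho> ({q. q $ 2 = 0 \<and> (\<exists>p\<in>K. q $ 1 = a * p $ 1 + 0)} \<union> {q. q $ 2 = 0 \<and> (\<exists>p\<in>K. q $ 1 = a * p $ 1 + (1 - a))}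
      \<union> {axis_projection 1 (vector [9/10, 9/10])})"
    using assms(2) by (intro covered_by_Un 1 covered_by_singleton) simp
  ultimately show ?thesis using covered_by_mono by blast
qed

text \<open>The projection satisfies \<open>N\<^sub>\<rho> \<le> 2 N\<^bsub>\<rho>/a\<^esub> + 1\<close>, the last square being for the image of \<open>S\<^sub>5\<close>.
Since \<open>a\<^sup>d = 1/2\<close>, the bound \<open>4 \<rho>\<^sup>-\<^sup>d - 1\<close> reproduces itself, its \<open>- 1\<close> absorbing the extra square.\<close>

lemma projection_cover:
  "a ^ n \<le> \<rho> \<Longrightarrow> \<rho> \<le> 1 / a \<Longrightarrow> \<exists>N. real N \<le> 4 * \<rho> powr (-d) - 1 \<and> covered_by N \<rho> K"
proof (induction n arbitrary: \<rho>)
  have stop: "\<exists>N. real N \<le> 4 * \<rho> powr (-d) - 1 \<and> covered_by N \<rho> K" if "1 \<le> \<rho>" "\<rho> \<le> 1 / a" for \<rho>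
  proof (intro exI[of _ 1] conjI)
    have "(1 / a) powr (-d) \<le> \<rho> powr (-d)" using that d_bounds by (intro powr_mono2') auto
    moreover have "(1 / a) powr (-d) = 1/2"
      using a_pos a_powr_d(1) by (simp add: powr_divide powr_minus field_simps)
    ultimately show "real 1 \<le> 4 * \<rho> powr (-d) - 1" by simp
    have "in_square \<rho> 0 p" if "p \<in> K" for p
      using that F_unit_square \<open>1 \<le> \<rho>\<close>
      by (auto simp: in_square_def axis_projection_def axis_def unit_square_def)
    then show "covered_by 1 \<rho> K" unfolding covered_by_def by (intro exI[of _ "{0}"]) auto
  qed
  {
    case (0 \<rho>)
    then show ?case by (intro stop) auto
  next
    case (Suc n \<rho>)
    show ?case
    proof (cases "1 \<le> \<rho>")
      case True
      then show ?thesis using Suc.prems by (intro stop)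
    next
      case False
      have pos: "\<rho> > 0" using Suc.prems(1) a_pos by (meson less_le_trans zero_less_power)
      have "a ^ n \<le> \<rho> / a" "\<rho> / a \<le> 1 / a" using Suc.prems False a_pos by (auto simp: field_simps)
      from Suc.IH[OF this] obtain N where N: "real N \<le> 4 * (\<rho> / a) powr (-d) - 1" "covered_by N (\<rho> / a) K"
        by blast
      have "(\<rho> / a) powr (-d) = \<rho> powr (-d) / 2" using a_powr_d by (simp add: powr_divide)
      then have "real (N + N + 1) \<le> 4 * \<rho> powr (-d) - 1" using N(1) by simp
      then show ?thesis using projection_cover_step[OF N(2) pos] by blast
    qed
  }
qed

text \<open>The orbit of 0 under \<open>S\<^sub>1\<close> and \<open>S\<^sub>4\<close>: left end points of the intervals of a Cantor set, placed on the
bottom side of the unit square.\<close>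

lemma bottom_points:
  "\<exists>P\<subseteq>F. finite P \<and> card P = 2 ^ j \<and> (\<forall>p\<in>P. p $ 2 = 0) \<and>
     (\<forall>p\<in>P. \<forall>q\<in>P. p \<noteq> q \<longrightarrow> (1 - 2 * a) * a ^ j \<le> \<bar>p $ 1 - q $ 1\<bar>)"
proof (induction j)
  case 0
  then show ?case using zero_in_F by (intro exI[of _ "{0}"]) auto
next
  case (Suc j)
  then obtain P where P: "P \<subseteq> F" "finite P" "card P = 2 ^ j" "\<And>p. p \<in> P \<Longrightarrow> p $ 2 = 0"
     "\<And>p q. p \<in> P \<Longrightarrow> q \<in> P \<Longrightarrow> p \<noteq> q \<Longrightarrow> (1 - 2 * a) * a ^ j \<le> \<bar>p $ 1 - q $ 1\<bar>" by blast
  have inj: "inj (S i)" if "i \<in> {1..4}" for i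
    using axis_affine_bij[OF axis_affine_ifs_map(1)[OF that]] a_pos by (simp add: bij_def)
  have x: "0 \<le> a * p $ 1" "a * p $ 1 \<le> a" if "p \<in> P" for p
    using that P(1) F_unit_square a_pos by (auto simp: unit_square_def mult_left_le)
  have far: "(1 - 2 * a) * a ^ Suc j \<le> S 4 q $ 1 - S 1 p $ 1" if "p \<in> P" "q \<in> P" for p q
  proof -
    have "(1 - 2 * a) * a ^ Suc j \<le> (1 - 2 * a) * 1"
      using a a_pos by (intro mult_left_mono power_le_one) auto
    then show ?thesis using x[OF that(1)] x[OF that(2)] by (simp add: ifs_map_component)
  qed
  have gap: "(1 - 2 * a) * a ^ Suc j > 0" using a a_pos by simp
  have near: "(1 - 2 * a) * a ^ Suc j \<le> \<bar>S i p $ 1 - S i q $ 1\<bar>"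
    if "i = 1 \<or> i = 4" "p \<in> P" "q \<in> P" "p \<noteq> q" for i p q
  proof -
    have "S i p $ 1 - S i q $ 1 = a * (p $ 1 - q $ 1)"
      using that(1) by (auto simp: ifs_map_component algebra_simps)
    then have "\<bar>S i p $ 1 - S i q $ 1\<bar> = a * \<bar>p $ 1 - q $ 1\<bar>" using a_pos by (simp add: abs_mult)
    moreover have "a * ((1 - 2 * a) * a ^ j) \<le> a * \<bar>p $ 1 - q $ 1\<bar>"
      using P(5)[OF that(2-)] a_pos by (intro mult_left_mono) auto
    ultimately show ?thesis by (simp add: mult_ac)
  qed
  have disj: "S 1 ` P \<inter> S 4 ` P = {}"
  proof (rule ccontr)
    assume "S 1 ` P \<inter> S 4 ` P \<noteq> {}"
    then obtain p q where "p \<in> P" "q \<in> P" "S 1 p = S 4 q" by blast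
    then show False using far[of p q] gap by simp
  qed
  let ?P = "S 1 ` P \<union> S 4 ` P"
  show ?case
  proof (intro exI[of _ ?P] conjI ballI impI)
    show "?P \<subseteq> F" using P(1) S_in_F by auto
    show "finite ?P" using P(2) by simp
    show "card ?P = 2 ^ Suc j"
      using P(2,3) disj inj[of 1] inj[of 4]
      by (subst card_Un_disjoint) (auto simp: card_image inj_on_subset)
    show "p $ 2 = 0" if "p \<in> ?P" for p using that P(4) by (auto simp: ifs_map_component)
    fix p q assume "p \<in> ?P" "q \<in> ?P" "p \<noteq> q"
    then consider i p' q' where "i = 1 \<or> i = 4" "p' \<in> P" "q' \<in> P" "p = S i p'" "q = S i q'"
      | p' q' where "p' \<in> P" "q' \<in> P" "p = S 1 p'" "q = S 4 q'"
      | p' q' where "p' \<in> P" "q' \<in> P" "p = S 4 p'" "q = S 1 q'"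
      by (elim UnE imageE) blast+
    then show "(1 - 2 * a) * a ^ Suc j \<le> \<bar>p $ 1 - q $ 1\<bar>"
    proof cases
      case 1
      then show ?thesis using near \<open>p \<noteq> q\<close> by blast
    next
      case 2
      then show ?thesis using far[of p' q'] by simp
    next
      case 3
      then show ?thesis using far[of q' p'] by simp
    qed
  qed
qed

lemma box_dim_projection_zero: "box_dim K = d"
proof (rule box_dim_eqI[of "1/2" "1 - 2 * a" 4])
  fix \<delta> :: real assume \<delta>: "0 < \<delta>" "\<delta> < 1"
  obtain n where n: "\<delta> \<le> a ^ n" "a ^ Suc n < \<delta>" using ex_power_bracket[of a \<delta>] a_pos \<delta> by auto
  have "1 \<le> 1 / a" using a_pos by simp
  then have "\<delta> \<le> 1 / a" using \<delta> by linarith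
  from projection_cover[OF less_imp_le[OF n(2)] this]
  show "\<exists>n. real n \<le> 4 * \<delta> powr (-d) \<and> covered_by n \<delta> K" by force
  obtain P where P: "P \<subseteq> F" "finite P" "card P = 2 ^ n"
     "\<And>p q. p \<in> P \<Longrightarrow> q \<in> P \<Longrightarrow> p \<noteq> q \<Longrightarrow> (1 - 2 * a) * a ^ n \<le> \<bar>p $ 1 - q $ 1\<bar>"
    using bottom_points[of n] by blast
  have sep: "(1 - 2 * a) * \<delta> \<le> infnorm (axis_projection 1 p - axis_projection 1 q)"
    if "p \<in> P" "q \<in> P" "p \<noteq> q" for p q
  proof -
    have "(1 - 2 * a) * \<delta> \<le> (1 - 2 * a) * a ^ n" using n(1) a by (intro mult_left_mono) auto
    also have "\<dots> \<le> \<bar>p $ 1 - q $ 1\<bar>" by (rule P(4)[OF that])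
    also have "\<dots> = infnorm (axis_projection 1 p - axis_projection 1 q)"
      by (simp add: infnorm_2 axis_projection_def axis_def)
    finally show ?thesis .
  qed
  have gap: "(1 - 2 * a) * \<delta> > 0" using a \<delta> by simp
  have "inj_on (axis_projection 1) P"
  proof (rule inj_onI, rule ccontr)
    fix p q assume "p \<in> P" "q \<in> P" "axis_projection 1 p = axis_projection 1 q" "p \<noteq> q"
    then show False using sep[of p q] gap by (simp add: infnorm_0)
  qed
  then have card: "card (axis_projection 1 ` P) = 2 ^ n" using P by (simp add: card_image)
  have "separated ((1 - 2 * a) * \<delta>) (axis_projection 1 ` P)"
    unfolding separated_def pairwise_def
  proof (intro conjI ballI impI)
    fix u v assume uv: "u \<in> axis_projection 1 ` P" "v \<in> axis_projection 1 ` P" "u \<noteq> v"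
    then obtain p q where "p \<in> P" "q \<in> P" "u = axis_projection 1 p" "v = axis_projection 1 q" by blast
    then show "(1 - 2 * a) * \<delta> \<le> infnorm (u - v)" using sep[of p q] uv(3) by blast
  qed (use P(2) in simp)
  moreover have "1/2 * \<delta> powr (-d) \<le> real (card (axis_projection 1 ` P))"
  proof -
    have "\<delta> powr (-d) \<le> (a ^ Suc n) powr (-d)" using n(2) d_bounds a_pos by (intro powr_mono2') auto
    also have "\<dots> = 2 ^ Suc n" using powr_power[OF a_pos(1), of "Suc n" "-d"] a_powr_d by simp
    finally show ?thesis unfolding card by simp
  qed
  ultimately show "\<exists>P\<subseteq>K. 1/2 * \<delta> powr (-d) \<le> real (card P) \<and> separated ((1 - 2 * a) * \<delta>) P"
    using P(1) by blast
qed (use a in auto)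

text \<open>Apply all words of length \<open>l\<close> over \<open>{1,2,3,4}\<close> to \<open>bottom_points\<close>.  Starting from the bottom side keeps
the heights at distance \<open>(1/3)\<^sup>l\<close> from 1, so that points coming from vertically adjacent rectangles differ in
height by at least that much.\<close>

lemma grid_points:
  "\<exists>Q\<subseteq>F. finite Q \<and> card Q = 4 ^ l * 2 ^ j \<and> (\<forall>p\<in>Q. p $ 2 \<le> 1 - (1/3) ^ l) \<and>
     (\<forall>p\<in>Q. \<forall>q\<in>Q. p \<noteq> q \<longrightarrow> (1 - 2 * a) * a ^ (j + l) \<le> \<bar>p $ 1 - q $ 1\<bar> \<or> (1/3) ^ l \<le> \<bar>p $ 2 - q $ 2\<bar>)"
proof (induction l)
  case 0
  obtain P where P: "P \<subseteq> F" "finite P" "card P = 2 ^ j" "\<forall>p\<in>P. p $ 2 = 0"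
     "\<forall>p\<in>P. \<forall>q\<in>P. p \<noteq> q \<longrightarrow> (1 - 2 * a) * a ^ j \<le> \<bar>p $ 1 - q $ 1\<bar>"
    using bottom_points[of j] by blast
  then show ?case by (intro exI[of _ P]) simp
next
  case (Suc l)
  then obtain Q where Q: "Q \<subseteq> F" "finite Q" "card Q = 4 ^ l * 2 ^ j" "\<And>p. p \<in> Q \<Longrightarrow> p $ 2 \<le> 1 - (1/3) ^ l"
     "\<And>p q. p \<in> Q \<Longrightarrow> q \<in> Q \<Longrightarrow> p \<noteq> q \<Longrightarrow>
        (1 - 2 * a) * a ^ (j + l) \<le> \<bar>p $ 1 - q $ 1\<bar> \<or> (1/3) ^ l \<le> \<bar>p $ 2 - q $ 2\<bar>"
    by blast
  define apart where "apart = (\<lambda>(p :: real^2) (q :: real^2). (1 - 2 * a) * a ^ (j + Suc l) \<le> \<bar>p $ 1 - q $ 1\<bar>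
      \<or> (1/3 :: real) ^ Suc l \<le> \<bar>p $ 2 - q $ 2\<bar>)"
  have sym: "apart p q \<longleftrightarrow> apart q p" for p q :: "real^2" by (simp add: apart_def abs_minus_commute)
  have gap: "(1 - 2 * a) * a ^ (j + Suc l) > 0" using a a_pos by simp
  have irrefl: "\<not> apart p p" for p :: "real^2"
    using gap by (simp add: apart_def not_le del: power_Suc)
  have inj: "inj (S i)" if "i \<in> {1..4}" for i
    using axis_affine_bij[OF axis_affine_ifs_map(1)[OF that]] a_pos by (simp add: bij_def)
  have x: "0 \<le> a * p $ 1" "a * p $ 1 \<le> a" "0 \<le> p $ 2" if "p \<in> Q" for p
    using that Q(1) F_unit_square a_pos by (auto simp: unit_square_def mult_left_le)
  have right: "apart (S i p) (S 4 q)" if "i \<in> {1..3}" "p \<in> Q" "q \<in> Q" for i p q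
  proof -
    have "(1 - 2 * a) * a ^ (j + Suc l) \<le> (1 - 2 * a) * 1"
      using a a_pos by (intro mult_left_mono power_le_one) auto
    also have "\<dots> \<le> \<bar>S i p $ 1 - S 4 q $ 1\<bar>"
    proof -
      have "S i p $ 1 = a * p $ 1" using that(1) by (auto simp: ifs_map_component)
      moreover have "S 4 q $ 1 = a * q $ 1 + (1 - a)" by (simp add: ifs_map_component)
      ultimately show ?thesis
        using x[OF that(2)] x[OF that(3)] abs_ge_minus_self[of "S i p $ 1 - S 4 q $ 1"] by argo
    qed
    finally have "(1 - 2 * a) * a ^ (j + Suc l) \<le> \<bar>S i p $ 1 - S 4 q $ 1\<bar>" .
    then show ?thesis by (simp add: apart_def)
  qed
  have up: "apart (S i p) (S i' q)" if "i \<in> {1..3}" "i' \<in> {1..3}" "i < i'" "p \<in> Q" "q \<in> Q" for i i' p q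
  proof -
    have "S i p $ 2 = p $ 2 / 3 + (real i - 1) / 3" "S i' q $ 2 = q $ 2 / 3 + (real i' - 1) / 3"
      using that by (auto simp: ifs_map_component)
    moreover have "real i + 1 \<le> real i'" using that(3) by linarith
    ultimately have "(1/3) ^ l / 3 \<le> S i' q $ 2 - S i p $ 2" 
      using x(3)[OF that(5)] Q(4)[OF that(4)] by argo
    then have "(1/3) ^ l / 3 \<le> \<bar>S i p $ 2 - S i' q $ 2\<bar>"
      using abs_ge_minus_self[of "S i p $ 2 - S i' q $ 2"] by argo
    then have "(1/3) ^ Suc l \<le> \<bar>S i p $ 2 - S i' q $ 2\<bar>" by simp
    then show ?thesis unfolding apart_def by blast
  qed
  have cross: "apart (S i p) (S i' q)"
    if "i \<in> {1..4}" "i' \<in> {1..4}" "i \<noteq> i'" "p \<in> Q" "q \<in> Q" for i i' p q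
  proof -
    have "i = 4 \<and> i' \<in> {1..3} \<or> i' = 4 \<and> i \<in> {1..3} \<or> i \<in> {1..3} \<and> i' \<in> {1..3} \<and> (i < i' \<or> i' < i)"
      using that(1-3) by auto
    then show ?thesis using right up that(4,5) sym by blast
  qed
  have same: "apart (S i p) (S i q)" if "i \<in> {1..4}" "p \<in> Q" "q \<in> Q" "p \<noteq> q" for i p q
  proof -
    have "S i p $ 1 - S i q $ 1 = a * (p $ 1 - q $ 1)" "S i p $ 2 - S i q $ 2 = (p $ 2 - q $ 2) / 3"
      using that(1) by (auto simp: ifs_map_component algebra_simps diff_divide_distrib)
    then have eq: "\<bar>S i p $ 1 - S i q $ 1\<bar> = a * \<bar>p $ 1 - q $ 1\<bar>" "\<bar>S i p $ 2 - S i q $ 2\<bar> = \<bar>p $ 2 - q $ 2\<bar> / 3"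
      using a_pos by (simp_all only: abs_mult abs_divide abs_numeral abs_of_pos)
    from Q(5)[OF that(2-)] show ?thesis
    proof
      assume "(1 - 2 * a) * a ^ (j + l) \<le> \<bar>p $ 1 - q $ 1\<bar>"
      then have "a * ((1 - 2 * a) * a ^ (j + l)) \<le> a * \<bar>p $ 1 - q $ 1\<bar>"
        using a_pos by (intro mult_left_mono) auto
      then show ?thesis unfolding apart_def eq by (simp add: mult_ac)
    next
      assume "(1/3) ^ l \<le> \<bar>p $ 2 - q $ 2\<bar>"
      then show ?thesis unfolding apart_def eq by simp
    qed
  qed
  let ?Q = "\<Union>i\<in>{1..4}. S i ` Q"
  have "card ?Q = (\<Sum>i\<in>{1..4::nat}. card (S i ` Q))"
  proof (rule card_UN_disjoint)
    show "\<forall>i\<in>{1..4}. \<forall>i'\<in>{1..4}. i \<noteq> i' \<longrightarrow> S i ` Q \<inter> S i' ` Q = {}"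
    proof (intro ballI impI, rule ccontr)
      fix i i' assume i: "i \<in> {1..4::nat}" "i' \<in> {1..4::nat}" "i \<noteq> i'" "S i ` Q \<inter> S i' ` Q \<noteq> {}"
      then obtain p q where "p \<in> Q" "q \<in> Q" "S i p = S i' q" by blast
      then show False using cross[OF i(1-3), of p q] irrefl by simp
    qed
  qed (simp_all add: Q(2))
  also have "\<dots> = (\<Sum>i\<in>{1..4::nat}. 4 ^ l * 2 ^ j)"
    using card_image[OF inj_on_subset[OF inj subset_UNIV]] Q(3) by (intro sum.cong refl) simp
  finally have card: "card ?Q = 4 ^ Suc l * 2 ^ j" by simp
  show ?case
  proof (intro exI[of _ ?Q] conjI ballI impI card)
    show "?Q \<subseteq> F" using Q(1) S_in_F by auto
    show "finite ?Q" using Q(2) by simp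
    show "p $ 2 \<le> 1 - (1/3) ^ Suc l" if "p \<in> ?Q" for p
    proof -
      obtain i q where "i \<in> {1..4}" "q \<in> Q" "p = S i q" using \<open>p \<in> ?Q\<close> by blast
      then have "p $ 2 \<le> q $ 2 / 3 + 2/3" by (auto simp: ifs_map_component)
      then show ?thesis using Q(4)[OF \<open>q \<in> Q\<close>] by simp
    qed
    fix p q assume "p \<in> ?Q" "q \<in> ?Q" "p \<noteq> q"
    then obtain i p' i' q' where iq: "i \<in> {1..4}" "p' \<in> Q" "p = S i p'" "i' \<in> {1..4}" "q' \<in> Q" "q = S i' q'"
      by blast
    have "apart p q"
    proof (cases "i = i'")
      case True
      then show ?thesis using same iq \<open>p \<noteq> q\<close> by blast
    next
      case False
      then show ?thesis using cross iq by blast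
    qed
    then show "(1 - 2 * a) * a ^ (j + Suc l) \<le> \<bar>p $ 1 - q $ 1\<bar> \<or> (1/3) ^ Suc l \<le> \<bar>p $ 2 - q $ 2\<bar>"
      by (simp only: apart_def)
  qed
qed

text \<open>Here \<open>m\<close> is the level at which the rectangles are no higher than \<open>\<delta>\<close>; from there on a cover of the
horizontal projection at scale \<open>\<delta> / a\<^sup>m\<close> suffices.  Going up one level costs four covers and one
square for the image of \<open>S\<^sub>5\<close>, which the \<open>- 1\<close> absorbs again.\<close>

lemma cylinder_cover:
  assumes "(1/3) ^ m \<le> \<delta>" "\<delta> \<le> a ^ m / a" "\<delta> > 0"
  shows "set w \<subseteq> {1..4} \<Longrightarrow> length w + k = m \<Longrightarrow>
    \<exists>N. real N \<le> 4 ^ k * (4 * (\<delta> / a ^ m) powr (-d)) - 1 \<and> covered_by N \<delta> (word_map a 0 w ` F)"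
proof (induction k arbitrary: w)
  case 0
  obtain t u where w: "\<And>v. word_map a 0 w v $ 1 = a ^ m * v $ 1 + t"
    "\<And>v. word_map a 0 w v $ 2 = (1/3) ^ m * v $ 2 + u"
    using word_map_diagonal[OF 0(1)] 0(2) by auto
  have am: "a ^ m > 0" using a_pos by simp
  obtain n where "a ^ n < \<delta> / a ^ m" using real_arch_pow_inv[of "\<delta> / a ^ m" a] assms(3) am a_pos by auto
  moreover have "\<delta> / a ^ m \<le> 1 / a" using assms(2) am a_pos by (simp add: field_simps)
  ultimately obtain N where N: "real N \<le> 4 * (\<delta> / a ^ m) powr (-d) - 1" "covered_by N (\<delta> / a ^ m) K"
    using projection_cover[of n "\<delta> / a ^ m"] by auto
  have "covered_by N (a ^ m * (\<delta> / a ^ m)) (word_map a 0 w ` F)"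
  proof (rule covered_by_affine[OF N(2) am, of _ t u])
    fix q assume "q \<in> word_map a 0 w ` F"
    then obtain p where p: "p \<in> F" "q = word_map a 0 w p" by blast
    have "0 \<le> p $ 2" "p $ 2 \<le> 1" using p F_unit_square by (auto simp: unit_square_def)
    then have "0 \<le> (1/3) ^ m * p $ 2" "(1/3) ^ m * p $ 2 \<le> (1/3) ^ m"
      by (auto simp: mult_left_le)
    moreover have "a ^ m * (\<delta> / a ^ m) = \<delta>" using a_pos by simp
    moreover have "q $ 2 = (1/3) ^ m * p $ 2 + u" using p(2) w(2) by simp
    ultimately have "u \<le> q $ 2" "q $ 2 \<le> u + a ^ m * (\<delta> / a ^ m)" using assms(1) by linarith+
    moreover have "q $ 1 = a ^ m * axis_projection 1 p $ 1 + t"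
      using p(2) w(1) by (simp add: axis_projection_def axis_def)
    ultimately show "\<exists>p\<in>K. q $ 1 = a ^ m * p $ 1 + t \<and> u \<le> q $ 2 \<and> q $ 2 \<le> u + a ^ m * (\<delta> / a ^ m)"
      using p(1) by blast
  qed
  moreover have "a ^ m * (\<delta> / a ^ m) = \<delta>" using a_pos by simp
  ultimately have "covered_by N \<delta> (word_map a 0 w ` F)" by (simp only:)
  then show ?case using N(1) by (intro exI[of _ N]) simp
next
  case (Suc k)
  define G where "G = 4 ^ k * (4 * (\<delta> / a ^ m) powr (-d))"
  let ?z = "word_map a 0 w (vector [9/10, 9/10])"
  have "\<exists>N. real N \<le> G - 1 \<and> covered_by N \<delta> (word_map a 0 (w @ [i]) ` F)" if "i \<in> {1..4}" for i
    unfolding G_def using Suc.prems that by (intro Suc.IH) auto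
  from covered_by_UN[where I = "{1..4::nat}" and B = "\<lambda>i. G - 1"
      and E = "\<lambda>i. word_map a 0 (w @ [i]) ` F", OF finite_atLeastAtMost this]
  obtain N where N: "real N \<le> (\<Sum>i\<in>{1..4::nat}. G - 1)"
    "covered_by N \<delta> (\<Union>i\<in>{1..4}. word_map a 0 (w @ [i]) ` F)" by blast
  have "word_map a 0 w ` F \<subseteq> (\<Union>i\<in>{1..4}. word_map a 0 (w @ [i]) ` F) \<union> {?z}"
  proof
    fix q assume "q \<in> word_map a 0 w ` F"
    then obtain p where p: "p \<in> F" "q = word_map a 0 w p" by blast
    from p(1) show "q \<in> (\<Union>i\<in>{1..4}. word_map a 0 (w @ [i]) ` F) \<union> {?z}"
    proof (cases rule: mem_F_cases)
      case (1 i r)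
      then have "q = word_map a 0 (w @ [i]) r" using p by (simp add: word_map_append) (simp add: word_map_def)
      then show ?thesis using 1 by blast
    qed (use p in simp)
  qed
  moreover have "covered_by (N + 1) \<delta> ((\<Union>i\<in>{1..4}. word_map a 0 (w @ [i]) ` F) \<union> {?z})"
    using N(2) assms(3) by (intro covered_by_Un covered_by_singleton) auto
  ultimately have "covered_by (N + 1) \<delta> (word_map a 0 w ` F)" using covered_by_mono by blast
  moreover have "real (N + 1) \<le> 4 ^ Suc k * (4 * (\<delta> / a ^ m) powr (-d)) - 1"
    using N(1) by (simp add: G_def)
  ultimately show ?case by blast
qed

text \<open>With \<open>(1/3)\<^sup>l \<approx> \<delta> \<approx> a\<^sup>n\<close> both estimates are \<open>4\<^sup>l 2\<^sup>n\<^sup>-\<^sup>l = 2\<^sup>n 2\<^sup>l\<close> up to constants, and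
\<open>2\<^sup>n \<approx> \<delta>\<^sup>-\<^sup>d\<close>, \<open>2\<^sup>l \<approx> \<delta>\<^sup>-\<^sup>e\<close>.\<close>

lemma box_dim_F_zero: "box_dim F = d + e"
proof (rule box_dim_eqI[of "1/4" "1 - 2 * a" 8])
  fix \<delta> :: real assume \<delta>: "0 < \<delta>" "\<delta> < 1"
  obtain l where l: "\<delta> \<le> (1/3) ^ l" "(1/3) ^ Suc l < \<delta>" using ex_power_bracket[of "1/3" \<delta>] \<delta> by auto
  obtain n where n: "\<delta> \<le> a ^ n" "a ^ Suc n < \<delta>" using ex_power_bracket[of a \<delta>] a_pos \<delta> by auto
  have split: "\<delta> powr (-(d + e)) = \<delta> powr (-d) * \<delta> powr (-e)" by (simp add: powr_add[symmetric])
  have thirds: "((1/3 :: real) ^ k) powr (-e) = 2 ^ k" for k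
    using powr_power[of "1/3" k "-e"] third_powr_e by simp
  have as: "(a ^ k) powr (-d) = 2 ^ k" for k
    using powr_power[OF a_pos(1), of k "-d"] a_powr_d by simp
  show "\<exists>N. real N \<le> 8 * \<delta> powr (-(d + e)) \<and> covered_by N \<delta> F"
  proof -
    \<comment> \<open>The level \<open>Suc l\<close> is the first at which the rectangles are lower than \<open>\<delta>\<close>.\<close>
    have "\<delta> \<le> a ^ Suc l / a" using l(1) power_a_le(1)[of l] a_pos by simp
    from cylinder_cover[OF less_imp_le[OF l(2)] this \<delta>(1), of "[]" "Suc l"]
    obtain N where N: "real N \<le> 4 ^ Suc l * (4 * (\<delta> / a ^ Suc l) powr (-d)) - 1" "covered_by N \<delta> F"
      by (auto simp: word_map_def)
    have "(\<delta> / a ^ Suc l) powr (-d) = \<delta> powr (-d) / 2 ^ Suc l"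
      using as[of "Suc l"] by (simp only: powr_divide)
    then have "real N \<le> 4 ^ Suc l * (4 * (\<delta> powr (-d) / 2 ^ Suc l))" using N(1) by simp
    also have "\<dots> = 8 * (\<delta> powr (-d) * 2 ^ l)"
    proof -
      have "(4::real) ^ l = 2 ^ l * 2 ^ l" by (simp add: power_mult_distrib[symmetric])
      then show ?thesis by simp
    qed
    also have "\<dots> \<le> 8 * (\<delta> powr (-d) * \<delta> powr (-e))"
    proof -
      have "2 ^ l \<le> \<delta> powr (-e)" unfolding thirds[symmetric] using l(1) \<delta> e_pos by (intro powr_mono2') auto
      then show ?thesis by (intro mult_left_mono) auto
    qed
    finally show ?thesis using N(2) unfolding split by blast
  qed
  \<comment> \<open>\<open>n\<close> counts the levels until the width, \<open>l\<close> those until the height reaches \<open>\<delta>\<close>.\<close>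
  have ln: "l \<le> n"
  proof (rule ccontr)
    assume "\<not> l \<le> n"
    then have "a ^ l \<le> a ^ Suc n" using a_pos by (intro power_decreasing) auto
    then show False using n(2) l(1) power_a_le(1)[of l] by linarith
  qed
  obtain Q where Q: "Q \<subseteq> F" "finite Q" "card Q = 4 ^ l * 2 ^ (n - l)"
     "\<And>p q. p \<in> Q \<Longrightarrow> q \<in> Q \<Longrightarrow> p \<noteq> q \<Longrightarrow>
        (1 - 2 * a) * a ^ (n - l + l) \<le> \<bar>p $ 1 - q $ 1\<bar> \<or> (1/3) ^ l \<le> \<bar>p $ 2 - q $ 2\<bar>"
    using grid_points[of l "n - l"] by blast
  have "(1 - 2 * a) * \<delta> \<le> infnorm (p - q)" if "p \<in> Q" "q \<in> Q" "p \<noteq> q" for p q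
  proof -
    have "(1 - 2 * a) * \<delta> \<le> (1 - 2 * a) * a ^ n" using n(1) a by (intro mult_left_mono) auto
    moreover have "(1 - 2 * a) * \<delta> \<le> 1 * \<delta>" using a \<delta> by (intro mult_right_mono) auto
    ultimately show ?thesis using Q(4)[OF that] ln l(1) by (auto simp: infnorm_2)
  qed
  then have "separated ((1 - 2 * a) * \<delta>) Q" using Q(2) by (simp add: separated_def pairwise_def)
  moreover have "1/4 * \<delta> powr (-(d + e)) \<le> real (card Q)"
  proof -
    have "\<delta> powr (-d) \<le> 2 ^ Suc n" unfolding as[symmetric] using n(2) d_bounds a_pos by (intro powr_mono2') auto
    moreover have "\<delta> powr (-e) \<le> 2 ^ Suc l" unfolding thirds[symmetric] using l(2) e_pos by (intro powr_mono2') auto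
    ultimately have "\<delta> powr (-d) * \<delta> powr (-e) \<le> 2 ^ Suc n * 2 ^ Suc l" by (intro mult_mono) auto
    also have "\<dots> = 4 * (2 ^ n * 2 ^ l)" by simp
    also have "(2::real) ^ n = 2 ^ (n - l) * 2 ^ l" using ln by (simp add: power_add[symmetric])
    also have "4 * (2 ^ (n - l) * 2 ^ l * 2 ^ l) = 4 * real (card Q)"
    proof -
      have "(4::real) ^ l = 2 ^ l * 2 ^ l" by (simp add: power_mult_distrib[symmetric])
      then show ?thesis unfolding Q(3) by simp
    qed
    finally show ?thesis unfolding split by simp
  qed
  ultimately show "\<exists>P\<subseteq>F. 1/4 * \<delta> powr (-(d + e)) \<le> real (card P) \<and> separated ((1 - 2 * a) * \<delta>) P"
    using Q(1) by blast
qed (use a in auto)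

lemma p1_word4:
  assumes "set w \<subseteq> {1..4}"
  shows "p1 a 0 w = d"
proof -
  obtain t u where w: "\<And>v. word_map a 0 w v $ 1 = a ^ length w * v $ 1 + t"
    "\<And>v. word_map a 0 w v $ 2 = (1/3) ^ length w * v $ 2 + u"
    using word_map_diagonal[OF assms] by auto
  have img: "(\<lambda>x. c * x + b) ` {0..1} = {b..b + c}" if "c > 0" for b c :: real
    using image_affinity_atLeastAtMost[of c b 0 1] that by (simp add: add.commute)
  have proj: "(\<lambda>v :: real^2. v $ j) ` unit_square = {0..1}" for j :: 2
  proof -
    have "x \<in> (\<lambda>v. v $ j) ` unit_square" if "0 \<le> x" "x \<le> 1" for x
      using that exhaust_2[of j]
      by (intro image_eqI[of _ _ "vector [x, x]"]) (auto simp: unit_square_def)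
    then show ?thesis using exhaust_2[of j] by (auto simp: unit_square_def)
  qed
  have "(\<lambda>v. v $ 1) ` word_map a 0 w ` unit_square = (\<lambda>x. a ^ length w * x + t) ` (\<lambda>v. v $ 1) ` unit_square"
    "(\<lambda>v. v $ 2) ` word_map a 0 w ` unit_square = (\<lambda>x. (1/3) ^ length w * x + u) ` (\<lambda>v. v $ 2) ` unit_square"
    by (simp_all add: image_image w)
  then have "(\<lambda>v. v $ 1) ` word_map a 0 w ` unit_square = {t..t + a ^ length w}"
    "(\<lambda>v. v $ 2) ` word_map a 0 w ` unit_square = {u..u + (1/3) ^ length w}"
    unfolding proj using img a_pos by simp_all
  then have "side_length 1 (word_map a 0 w ` unit_square) = a ^ length w"
    "side_length 2 (word_map a 0 w ` unit_square) = (1/3) ^ length w"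
    unfolding side_length_def using a_pos by (simp_all add: diameter_closed_interval)
  then have "longest_axis (word_map a 0 w ` cbox 0 One) = 1"
    unfolding longest_axis_def unit_square_cbox using power_a_le(1)[of "length w"] by simp
  then show ?thesis unfolding p1_def by (simp only: box_dim_projection_zero)
qed

lemma word_map_constant:
  "5 \<in> set w \<Longrightarrow> set w \<subseteq> {1..5} \<Longrightarrow> \<exists>c. \<forall>v. word_map a 0 w v = c"
proof (induction w)
  case (Cons i w)
  show ?case
  proof (cases "i = 5")
    case True
    then have "word_map a 0 (i # w) v = vector [9/10, 9/10]" for v
      by (simp add: word_map_Cons vec2_eq_iff ifs_map_component)
    then show ?thesis by blast
  next
    case False
    then obtain c where "\<And>v. word_map a 0 w v = c" using Cons by auto
    then have "word_map a 0 (i # w) v = S i c" for v by (simp add: word_map_Cons)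
    then show ?thesis by blast
  qed
qed simp

lemma alpha1_word5:
  assumes "5 \<in> set w" "set w \<subseteq> {1..5}"
  shows "alpha1 (linear_part (word_map a 0 w)) = 0"
proof -
  have "axis_affine (word_map a 0 w) 0 0"
    using word_map_constant[OF assms] unfolding axis_affine_def by force
  from alpha_axis_affine(1)[OF this] show ?thesis by simp
qed

lemma pressure_sum_zero: "pressure_sum a 0 s k = (2 * (1/3) powr (s - d)) ^ k"
proof -
  let ?W = "{w. length w = k \<and> set w \<subseteq> {1..4::nat}}"
  let ?f = "\<lambda>w. alpha1 (linear_part (word_map a 0 w)) powr p1 a 0 w
                   * alpha2 (linear_part (word_map a 0 w)) powr (s - p1 a 0 w)"
  have "?f w = 0" if "w \<in> words k - ?W" for w
  proof -
    have w: "length w = k" "set w \<subseteq> {1..5}" "\<not> set w \<subseteq> {1..4}" using that unfolding words_def by blast+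
    then obtain i where "i \<in> set w" "i \<notin> {1..4}" by blast
    moreover have "i \<in> {1..5}" using w \<open>i \<in> set w\<close> by blast
    ultimately have "i = 5" by auto
    then have "5 \<in> set w" using \<open>i \<in> set w\<close> by simp
    then show ?thesis using alpha1_word5 w by simp
  qed
  moreover have "?W \<subseteq> words k" by (auto simp: words_def subset_iff)
  ultimately have "pressure_sum a 0 s k = (\<Sum>w\<in>?W. ?f w)"
    unfolding pressure_sum_def using card_words(2) by (intro sum.mono_neutral_right) auto
  also have "\<dots> = (\<Sum>w\<in>?W. (1/2 * (1/3) powr (s - d)) ^ k)"
  proof (rule sum.cong[OF refl])
    fix w assume w: "w \<in> ?W"
    then have "?f w = (a ^ k) powr d * ((1/3) ^ k) powr (s - d)"
      using alpha_word4[of w] p1_word4[of w] by simp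
    also have "\<dots> = (1/2 * (1/3) powr (s - d)) ^ k"
      using powr_power[OF a_pos(1), of k d] powr_power[of "1/3" k "s - d"] a_powr_d(1)
      by (simp only: power_mult_distrib)
    finally show "?f w = (1/2 * (1/3) powr (s - d)) ^ k" .
  qed
  also have "\<dots> = (4 * (1/2 * (1/3) powr (s - d))) ^ k"
    using card_words4[of k] by (simp only: sum_constant power_mult_distrib of_nat_power of_nat_numeral)
  finally show ?thesis by simp
qed

lemma pressure_zero: "pressure a 0 s = 2 * (1/3) powr (s - d)"
proof -
  define c where "c = 2 * (1/3 :: real) powr (s - d)"
  have c: "c > 0" by (simp add: c_def)
  have "\<forall>\<^sub>F k in sequentially. pressure_sum a 0 s k powr (1 / real k) = c"
    using eventually_ge_at_top[of 1]
  proof eventually_elim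
    case (elim k)
    then show ?case unfolding pressure_sum_zero c_def[symmetric]
      using c by (simp add: powr_realpow[symmetric] powr_powr)
  qed
  then have "(\<lambda>k. pressure_sum a 0 s k powr (1 / real k)) \<longlonglongrightarrow> c" by (rule tendsto_eventually)
  then show ?thesis unfolding pressure_def c_def by (rule limI)
qed

text \<open>By \<open>a\<^sup>-\<^sup>d = 2\<close> this says \<open>(3a)\<^sup>1\<^sup>-\<^sup>d > 1\<close>, where \<open>a > 1/3\<close> and \<open>d < 1\<close> enter.  Both jumps are
measured by this quotient.\<close>

lemma gap: "(1/3) powr (1 - d) < 2 * a"
proof -
  have "(1/3) powr (1 - d) < a powr (1 - d)" using a d_bounds by (intro powr_less_mono2) auto
  also have "a powr (1 - d) = a powr 1 * a powr (-d)" by (simp only: powr_add[symmetric]) simp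
  also have "\<dots> = 2 * a" using a_powr_d a_pos by simp
  finally show ?thesis .
qed

lemma pressure_zero_less: "pressure a 0 s < 4 * a * (1/3) powr (s - 1)"
proof -
  have "(1/3 :: real) powr (s - d) = (1/3) powr (s - 1) * (1/3) powr (1 - d)"
    by (simp add: powr_add[symmetric])
  also have "\<dots> < (1/3) powr (s - 1) * (2 * a)" using gap by (intro mult_strict_left_mono) auto
  finally show ?thesis unfolding pressure_zero by (simp add: mult_ac)
qed

lemma box_dim_zero_less: "box_dim F < 1 + ln (4 * a) / ln 3"
proof -
  have "ln ((1/3) powr (1 - d)) < ln (2 * a)" using gap a_pos by (subst ln_less_cancel_iff) auto
  then have "(1 - d) * (- ln 3) < ln (2 * a)" by (simp add: ln_powr ln_div)
  moreover have "ln (4 * a) = ln 2 + ln (2 * a)" using a_pos ln_mult[of 2 "2 * a"] by simp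
  ultimately have "ln 2 + d * ln 3 < ln 3 + ln (4 * a)" by (simp add: algebra_simps)
  moreover have l3: "ln (3::real) > 0" by simp
  ultimately have "(ln 2 + d * ln 3) / ln 3 < (ln 3 + ln (4 * a)) / ln 3" by (intro divide_strict_right_mono)
  then show ?thesis unfolding box_dim_F_zero e_def using l3 by (simp add: add_divide_distrib)
qed

end

section \<open>The discontinuities\<close>

lemma not_continuous_at_zero:
  fixes f :: "real \<Rightarrow> real"
  assumes "b > 0" "f 0 < c" "\<And>x. 0 < x \<Longrightarrow> x \<le> b \<Longrightarrow> c \<le> f x"
  shows "\<not> continuous (at 0 within {0..b}) f"
proof
  assume "continuous (at 0 within {0..b}) f"
  then have "(f \<longlongrightarrow> f 0) (at_right 0)"
    using assms(1) by (simp add: continuous_within at_within_Icc_at_right)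
  moreover have "\<forall>\<^sub>F x in at_right 0. c \<le> f x"
    using assms by (intro eventually_at_rightI[of 0 b]) auto
  ultimately have "c \<le> f 0" by (rule tendsto_lowerbound) simp
  then show False using assms(2) by simp
qed

theorem mainTheorem3:
  fixes a :: real
  assumes "1/3 < a" and "a < 1/2"
  shows "(\<forall>s. \<not> continuous (at 0 within {0..1/10}) (\<lambda>\<epsilon>. pressure a \<epsilon> s)) \<and>
         \<not> continuous (at 0 within {0..1/10}) (\<lambda>\<epsilon>. box_dim (attractor a \<epsilon>))"
proof -
  interpret zero: carpet_zero a using assms by unfold_locales auto
  have pos: "carpet_pos a \<epsilon>" if "0 < \<epsilon>" "\<epsilon> \<le> 1/10" for \<epsilon>
    using assms that by unfold_locales auto
  show ?thesis
  proof (intro conjI allI)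
    fix s
    show "\<not> continuous (at 0 within {0..1/10}) (\<lambda>\<epsilon>. pressure a \<epsilon> s)"
      using zero.pressure_zero_less[of s] carpet_pos.pressure_ge[OF pos]
      by (intro not_continuous_at_zero) auto
    show "\<not> continuous (at 0 within {0..1/10}) (\<lambda>\<epsilon>. box_dim (attractor a \<epsilon>))"
      using zero.box_dim_zero_less less_imp_le[OF carpet_pos.box_dim_F_gt[OF pos]]
      by (intro not_continuous_at_zero) auto
  qed
qed

end
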